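(* Let $\mathbf{X}$ be a computably admissible, computably compact Hausdorff represented space admitting a proper computable dyadic subbase. Then there exist a representation $\delta :\subseteq \{0,1\}^\omega \to \mathbf{X}$ of $\mathbf{X}$ and a $\mathbb{T}^\omega$-representation $\psi :\subseteq \mathbb{T}^\omega \to \mathcal{K}(\mathbf{X})$ of $\mathcal{K}(\mathbf{X})$ which match, i.e.\ for all $A \in \mathcal{K}(\mathbf{X})$ and all $x \in \mathbf{X}$: $$x \in A \iff \forall p \in \psi^{-1}(A)\ \exists q \in \{0,1\}^\omega\ (p \preceq q \wedge \delta(q) = x) \iff \exists p \in \psi^{-1}(A)\ \exists q \in \{0,1\}^\omega\ (p \preceq q \wedge \delta(q) = x).$$
   Context: A represented space is a pair $\mathbf{X}=(X,\delta_X)$ with $\delta_X :\subseteq \{0,1\}^\omega \to X$ a partial surjection. A (multivalued) map $f :\subseteq \mathbf{X} \rightrightarrows \mathbf{Y}$ is computable (continuous) if some computable (continuous) $F :\subseteq \{0,1\}^\omega \to \{0,1\}^\omega$ satisfies $\delta_Y(F(p)) \in f(\delta_X(p))$ for all $p \in \operatorname{dom}(f\circ\delta_X)$. Sierpiński space $\mathbb{S}=\{\bot,\top\}$ has $\delta_\mathbb{S}(0^\omega)=\bot$ and $\delta_\mathbb{S}(p)=\top$ for $p\neq 0^\omega$. $\mathcal{C}(\mathbf{X},\mathbf{Y})$ denotes the continuous functions with the standard function-space representation (for which evaluation and composition are computable). $\mathcal{O}(\mathbf{X})$: open sets $U$ represented via $\chi_U \in \mathcal{C}(\mathbf{X},\mathbb{S})$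 ($\chi_U(x)=\top$ iff $x\in U$); the topology of $\mathbf{X}$ is the final topology of $\delta_X$ (whose open sets are those in $\mathcal{O}(\mathbf{X})$), and "Hausdorff" refers to it. $\mathcal{A}(\mathbf{X})$: closed sets $A$ represented by a $\mathcal{O}(\mathbf{X})$-name of $X\setminus A$. $\mathcal{K}(\mathbf{X})$: compact sets $A$ represented by $\{U \in \mathcal{O}(\mathbf{X}) \mid A \subseteq U\} \in \mathcal{O}(\mathcal{O}(\mathbf{X}))$. $\mathbf{X}$ is computably compact if $\mathrm{isEmpty}: \mathcal{A}(\mathbf{X}) \to \mathbb{S}$ (with value $\top$ exactly on $\emptyset$) is computable. $\mathbf{X}$ is computably admissible if $x \mapsto \{U \in \mathcal{O}(\mathbf{X}) \mid x \in U\}$, $\mathbf{X} \to \mathcal{O}(\mathcal{O}(\mathbf{X}))$, is injective with computable partial inverse. Plotkin's $\mathbb{T}=\{0,1,\bot\}$ (topology generated by $\{\{0\},\{1\}\}$) is represented by $\delta_\mathbb{T}(0^\omega)=\bot$, $\delta_\mathbb{T}(p)=0$ if $\min\{n \mid p(n)=1\}$ is even and $=1$ if it is odd; $\mathbb{T}^\omega$ carries the induced product representation $\delta_{\mathbb{T}^\omega}$. A $\mathbb{T}^\omega$-representation of a set $Y$ is a partial surjection $\psi :\subseteq \mathbb{T}^\omega \to Y$. For $p,q \in \mathbb{T}^\omega$, $p \preceq q$ means $p(n)\neq\bot \Rightarrow p(n)=q(n)$ for all $n$; $\{0,1\}^\omega \subseteq \mathbb{T}^\omega$. A representation of the represented space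 $\mathbf{X}$ means a representation computably equivalent to $\delta_X$ (identity computable in both directions); a $\mathbb{T}^\omega$-representation $\psi$ of $\mathcal{K}(\mathbf{X})$ means one for which $\psi\circ\delta_{\mathbb{T}^\omega}$ is computably equivalent to the standard representation of $\mathcal{K}(\mathbf{X})$. A dyadic subbase of $\mathbf{X}$ is a map $S:\mathbb{N}\times\{0,1\}\to\mathcal{O}(\mathbf{X})$, $(n,i)\mapsto S_{n,i}$, whose image is a subbase of the topology of $\mathbf{X}$ and with $S_{n,0}\cap S_{n,1}=\emptyset$ for all $n$. Let $S_{n,\bot}=X\setminus(S_{n,0}\cup S_{n,1})$ and $\varphi_S:X\to\mathbb{T}^\omega$, $\varphi_S(x)(n)=a$ iff $x\in S_{n,a}$ ($a\in\{0,1,\bot\}$). $S$ is computable if $S$ is computable and $\varphi_S$ as well as its partial inverse are computable (with $\mathbb{T}^\omega$ represented by $\delta_{\mathbb{T}^\omega}$). For $p\in\mathbb{T}^\omega$ let $\operatorname{dom}(p)=\{k\mid p(k)\neq\bot\}$, $S(p)=\bigcap_{k\in\operatorname{dom}(p)}S_{k,p(k)}$ and $\bar S(p)=\bigcap_{k\in\operatorname{dom}(p)}(X\setminus S_{k,1-p(k)})$. A finite sequence $e$ over $\mathbb{T}$ is identified with $e\bot^\omega$. $S$ is proper if $\mathrm{cl}\,S(e)=\bar S(e)$ for every finite sequence $e$ over $\mathbb{T}$. *)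

theory Defs
  imports "HOL-Analysis.Analysis" "HOL-Library.Nat_Bijection" "HOL-Library.FuncSet"
begin

section \<open>Computability on Cantor space\<close>

type_synonym cantor = "nat \<Rightarrow> bool"

definition minimize :: "(nat \<Rightarrow> nat option) \<Rightarrow> nat option" where
  "minimize g =
     (if \<exists>n. g n = Some 0 \<and> (\<forall>m<n. \<exists>v. g m = Some (Suc v))
      then Some (LEAST n. g n = Some 0) else None)"

text \<open>
  Kleene's partial recursive functionals: the partial functions on \<open>\<nat>\<close> that are partial recursive
  relative to an oracle \<open>p\<close>, uniformly in \<open>p\<close>. They are unary; several arguments are passed through
  the Cantor pairing function.
\<close>

inductive partial_recursive :: "(cantor \<Rightarrow> nat \<Rightarrow> nat option) \<Rightarrow> bool" where
  pr_zero: "partial_recursive (\<lambda>p n. Some 0)"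
| pr_succ: "partial_recursive (\<lambda>p n. Some (Suc n))"
| pr_fst: "partial_recursive (\<lambda>p n. Some (fst (prod_decode n)))"
| pr_snd: "partial_recursive (\<lambda>p n. Some (snd (prod_decode n)))"
| pr_oracle: "partial_recursive (\<lambda>p n. Some (of_bool (p n)))"
| pr_pair: "partial_recursive f \<Longrightarrow> partial_recursive g \<Longrightarrow>
    partial_recursive (\<lambda>p n. Option.bind (f p n) (\<lambda>a.
      Option.bind (g p n) (\<lambda>b. Some (prod_encode (a, b)))))"
| pr_comp: "partial_recursive f \<Longrightarrow> partial_recursive g \<Longrightarrow>
    partial_recursive (\<lambda>p n. Option.bind (g p n) (f p))"
| pr_rec: "partial_recursive f \<Longrightarrow> partial_recursive g \<Longrightarrow>
    partial_recursive (\<lambda>p c. case prod_decode c of (a, n) \<Rightarrow>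
      rec_nat (f p a)
        (\<lambda>k r. Option.bind r (\<lambda>v. g p (prod_encode (a, prod_encode (k, v))))) n)"
| pr_min: "partial_recursive f \<Longrightarrow>
    partial_recursive (\<lambda>p a. minimize (\<lambda>n. f p (prod_encode (a, n))))"

text \<open>The functional may converge outside the domain of \<open>F\<close>: restrictions of computable partial
  functions count as computable.\<close>

definition computable :: "(cantor \<rightharpoonup> cantor) \<Rightarrow> bool" where
  "computable F \<longleftrightarrow>
     (\<exists>\<Phi>. partial_recursive \<Phi> \<and>
          (\<forall>p q. F p = Some q \<longrightarrow> (\<forall>n. \<Phi> p n = Some (of_bool (q n)))))"


section \<open>Represented spaces\<close>

text \<open>A represented space is given by its representation; its underlying set is the range.\<close>

type_synonym 'a rspace = "cantor \<rightharpoonup> 'a"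

definition realizes ::
  "(cantor \<rightharpoonup> cantor) \<Rightarrow> 'a rspace \<Rightarrow> 'b rspace \<Rightarrow> ('a \<rightharpoonup> 'b) \<Rightarrow> bool" where
  "realizes F X Y f \<longleftrightarrow>
     (\<forall>p x y. X p = Some x \<longrightarrow> f x = Some y \<longrightarrow> (\<exists>q. F p = Some q \<and> Y q = Some y))"

definition computable_map :: "'a rspace \<Rightarrow> 'b rspace \<Rightarrow> ('a \<rightharpoonup> 'b) \<Rightarrow> bool" where
  "computable_map X Y f \<longleftrightarrow> (\<exists>F. computable F \<and> realizes F X Y f)"

definition rep_equiv :: "'a rspace \<Rightarrow> 'a rspace \<Rightarrow> bool" where
  "rep_equiv X Y \<longleftrightarrow> computable_map X Y Some \<and> computable_map Y X Some"

definition partial_inverse :: "'a set \<Rightarrow> ('a \<Rightarrow> 'b) \<Rightarrow> ('b \<rightharpoonup> 'a)" where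
  "partial_inverse A f y = (if y \<in> f ` A then Some (inv_into A f y) else None)"

text \<open>The final topology of the representation.\<close>

definition rtop :: "'a rspace \<Rightarrow> 'a topology" where
  "rtop X = topology (\<lambda>U. U \<subseteq> ran X \<and>
     openin (top_of_set (dom X)) {p \<in> dom X. the (X p) \<in> U})"

definition nat_rep :: "nat rspace" where
  "nat_rep p = (if \<exists>n. p n then Some (LEAST n. p n) else None)"

definition bit_rep :: "bool rspace" where
  "bit_rep p = Some (p 0)"

definition prod_rep :: "'a rspace \<Rightarrow> 'b rspace \<Rightarrow> ('a \<times> 'b) rspace" where
  "prod_rep X Y p =
     Option.bind (X (\<lambda>n. p (2 * n))) (\<lambda>x.
       Option.bind (Y (\<lambda>n. p (2 * n + 1))) (\<lambda>y. Some (x, y)))"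

definition seq_rep :: "'a rspace \<Rightarrow> (nat \<Rightarrow> 'a) rspace" where
  "seq_rep X p =
     (if \<forall>n. (\<lambda>m. p (prod_encode (n, m))) \<in> dom X
      then Some (\<lambda>n. the (X (\<lambda>m. p (prod_encode (n, m))))) else None)"

text \<open>Sierpinski space, with \<^const>\<open>True\<close> as the open point \<open>\<top>\<close>.\<close>

definition sierpinski :: "bool rspace" where
  "sierpinski p = Some (\<exists>n. p n)"


section \<open>Function spaces and hyperspaces\<close>

text \<open>The word \<open>p(0) \<dots> p(k-1)\<close> is coded by the number with binary numeral \<open>1 p(0) \<dots> p(k-1)\<close>.\<close>

primrec prefix_code :: "cantor \<Rightarrow> nat \<Rightarrow> nat" where
  "prefix_code p 0 = 1"
| "prefix_code p (Suc k) = 2 * prefix_code p k + of_bool (p k)"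

text \<open>
  The partial continuous function on Cantor space with Kleene associate \<open>q\<close>. To produce the
  \<open>n\<close>-th output bit, longer and longer prefixes \<open>w\<close> of \<open>p\<close> are presented to \<open>q\<close>; the bit of \<open>q\<close> at
  \<open>2\<langle>n,w\<rangle>\<close> tells whether \<open>w\<close> suffices, and if so the bit at \<open>2\<langle>n,w\<rangle> + 1\<close> is the output.
\<close>

definition associate :: "cantor \<Rightarrow> (cantor \<rightharpoonup> cantor)" where
  "associate q p =
     (let c = (\<lambda>n k. prod_encode (n, prefix_code p k)) in
      if \<forall>n. \<exists>k. q (2 * c n k)
      then Some (\<lambda>n. q (2 * c n (LEAST k. q (2 * c n k)) + 1)) else None)"

text \<open>
  Every partial continuous function on Cantor space has an extension of the form
  \<^term>\<open>associate q\<close>, so the functions named below are those with a continuous realizer.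
  They are made unique outside the underlying set of \<open>X\<close> by extensionality.
\<close>

definition function_name :: "'a rspace \<Rightarrow> 'b rspace \<Rightarrow> cantor \<Rightarrow> ('a \<Rightarrow> 'b) \<Rightarrow> bool" where
  "function_name X Y q f \<longleftrightarrow>
     f \<in> extensional (ran X) \<and> realizes (associate q) X Y (\<lambda>x. Some (f x))"

definition function_rep :: "'a rspace \<Rightarrow> 'b rspace \<Rightarrow> ('a \<Rightarrow> 'b) rspace" where
  "function_rep X Y q =
     (if \<exists>f. function_name X Y q f then Some (THE f. function_name X Y q f) else None)"

definition open_rep :: "'a rspace \<Rightarrow> 'a set rspace" where
  "open_rep X q = map_option (\<lambda>f. {x \<in> ran X. f x}) (function_rep X sierpinski q)"

definition closed_rep :: "'a rspace \<Rightarrow> 'a set rspace" where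
  "closed_rep X q = map_option (\<lambda>U. ran X - U) (open_rep X q)"

text \<open>
  The open supersets of a set determine only its saturation, so in general one takes saturated
  compact sets. In a T1 space, hence in a Hausdorff space, every set is saturated.
\<close>

definition compact_name :: "'a rspace \<Rightarrow> cantor \<Rightarrow> 'a set \<Rightarrow> bool" where
  "compact_name X q A \<longleftrightarrow>
     compactin (rtop X) A \<and> A = \<Inter>{U. openin (rtop X) U \<and> A \<subseteq> U} \<and>
     open_rep (open_rep X) q = Some {U \<in> ran (open_rep X). A \<subseteq> U}"

definition compact_rep :: "'a rspace \<Rightarrow> 'a set rspace" where
  "compact_rep X q =
     (if \<exists>A. compact_name X q A then Some (THE A. compact_name X q A) else None)"

definition computably_compact :: "'a rspace \<Rightarrow> bool" where
  "computably_compact X \<longleftrightarrow> computable_map (closed_rep X) sierpinski (\<lambda>A. Some (A = {}))"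

definition nbhd_filter :: "'a rspace \<Rightarrow> 'a \<Rightarrow> 'a set set" where
  "nbhd_filter X x = {U \<in> ran (open_rep X). x \<in> U}"

definition computably_admissible :: "'a rspace \<Rightarrow> bool" where
  "computably_admissible X \<longleftrightarrow>
     inj_on (nbhd_filter X) (ran X) \<and>
     computable_map (open_rep (open_rep X)) X (partial_inverse (ran X) (nbhd_filter X))"


section \<open>Plotkin's \<open>\<bbbT>\<close> and dyadic subbases\<close>

text \<open>The points \<open>\<bottom>, 0, 1\<close> are \<^term>\<open>None\<close>, \<^term>\<open>Some False\<close>, \<^term>\<open>Some True\<close>.\<close>

type_synonym plotkin = "bool option"

definition plotkin_rep :: "plotkin rspace" where
  "plotkin_rep p = Some (if \<exists>n. p n then Some (odd (LEAST n. p n)) else None)"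

definition plotkin_seq_rep :: "(nat \<Rightarrow> plotkin) rspace" where
  "plotkin_seq_rep = seq_rep plotkin_rep"

definition total_seq :: "cantor \<Rightarrow> (nat \<Rightarrow> plotkin)" where
  "total_seq q n = Some (q n)"

definition refines :: "(nat \<Rightarrow> plotkin) \<Rightarrow> (nat \<Rightarrow> plotkin) \<Rightarrow> bool" (infix \<open>\<preceq>\<^sub>T\<close> 50) where
  "p \<preceq>\<^sub>T q \<longleftrightarrow> (\<forall>n. p n \<noteq> None \<longrightarrow> p n = q n)"

definition finite_seq :: "plotkin list \<Rightarrow> (nat \<Rightarrow> plotkin)" where
  "finite_seq e n = (if n < length e then e ! n else None)"

text \<open>The empty intersection of subbasic sets is the whole space, whence the
  \<^term>\<open>insert (ran X)\<close>.\<close>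

definition dyadic_subbase :: "'a rspace \<Rightarrow> (nat \<Rightarrow> bool \<Rightarrow> 'a set) \<Rightarrow> bool" where
  "dyadic_subbase X S \<longleftrightarrow>
     (\<forall>n i. S n i \<in> ran (open_rep X)) \<and>
     rtop X = topology_generated_by (insert (ran X) {S n i | n i. True}) \<and>
     (\<forall>n. S n False \<inter> S n True = {})"

definition subbase_map :: "(nat \<Rightarrow> bool \<Rightarrow> 'a set) \<Rightarrow> 'a \<Rightarrow> (nat \<Rightarrow> plotkin)" where
  "subbase_map S x n =
     (if x \<in> S n False then Some False else if x \<in> S n True then Some True else None)"

definition computable_dyadic_subbase :: "'a rspace \<Rightarrow> (nat \<Rightarrow> bool \<Rightarrow> 'a set) \<Rightarrow> bool" where
  "computable_dyadic_subbase X S \<longleftrightarrow>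
     dyadic_subbase X S \<and>
     computable_map (prod_rep nat_rep bit_rep) (open_rep X) (\<lambda>(n, i). Some (S n i)) \<and>
     computable_map X plotkin_seq_rep (\<lambda>x. Some (subbase_map S x)) \<and>
     inj_on (subbase_map S) (ran X) \<and>
     computable_map plotkin_seq_rep X (partial_inverse (ran X) (subbase_map S))"

definition subbase_cell :: "'a rspace \<Rightarrow> (nat \<Rightarrow> bool \<Rightarrow> 'a set) \<Rightarrow> (nat \<Rightarrow> plotkin) \<Rightarrow> 'a set" where
  "subbase_cell X S p = {x \<in> ran X. \<forall>k a. p k = Some a \<longrightarrow> x \<in> S k a}"

definition subbase_closed_cell ::
  "'a rspace \<Rightarrow> (nat \<Rightarrow> bool \<Rightarrow> 'a set) \<Rightarrow> (nat \<Rightarrow> plotkin) \<Rightarrow> 'a set" where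
  "subbase_closed_cell X S p = {x \<in> ran X. \<forall>k a. p k = Some a \<longrightarrow> x \<notin> S k (\<not> a)}"

definition proper_subbase :: "'a rspace \<Rightarrow> (nat \<Rightarrow> bool \<Rightarrow> 'a set) \<Rightarrow> bool" where
  "proper_subbase X S \<longleftrightarrow>
     (\<forall>e. rtop X closure_of subbase_cell X S (finite_seq e) =
          subbase_closed_cell X S (finite_seq e))"


section \<open>Basic facts\<close>

lemma openin_rtop:
  "openin (rtop X) U \<longleftrightarrow>
     U \<subseteq> ran X \<and> openin (top_of_set (dom X)) {p \<in> dom X. the (X p) \<in> U}"
proof -
  have "istopology (\<lambda>U. U \<subseteq> ran X \<and>
     openin (top_of_set (dom X)) {p \<in> dom X. the (X p) \<in> U})"
    unfolding istopology_def
  proof (intro conjI allI impI)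
    fix U V
    assume "U \<subseteq> ran X \<and> openin (top_of_set (dom X)) {p \<in> dom X. the (X p) \<in> U}"
      and "V \<subseteq> ran X \<and> openin (top_of_set (dom X)) {p \<in> dom X. the (X p) \<in> V}"
    moreover have "{p \<in> dom X. the (X p) \<in> U \<inter> V} =
        {p \<in> dom X. the (X p) \<in> U} \<inter> {p \<in> dom X. the (X p) \<in> V}"
      by blast
    ultimately show "U \<inter> V \<subseteq> ran X" and
      "openin (top_of_set (dom X)) {p \<in> dom X. the (X p) \<in> U \<inter> V}"
      by (auto simp only: intro: openin_Int)
  next
    fix \<U>
    assume *: "\<forall>U\<in>\<U>. U \<subseteq> ran X \<and> openin (top_of_set (dom X)) {p \<in> dom X. the (X p) \<in> U}"
    then show "\<Union>\<U> \<subseteq> ran X"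
      by blast
    have "{p \<in> dom X. the (X p) \<in> \<Union>\<U>} = \<Union>((\<lambda>U. {p \<in> dom X. the (X p) \<in> U}) ` \<U>)"
      by blast
    with * show "openin (top_of_set (dom X)) {p \<in> dom X. the (X p) \<in> \<Union>\<U>}"
      by (auto simp only: intro!: openin_Union)
  qed
  then show ?thesis
    by (simp add: rtop_def topology_inverse')
qed

lemma topspace_rtop [simp]: "topspace (rtop X) = ran X"
proof -
  have "{p \<in> dom X. the (X p) \<in> ran X} = dom X"
    by (auto simp: ran_def)
  then have "openin (rtop X) (ran X)"
    unfolding openin_rtop by simp
  moreover have "topspace (rtop X) \<subseteq> ran X"
    using iffD1[OF openin_rtop openin_topspace] by (rule conjunct1)
  ultimately show ?thesis
    using openin_subset by blast
qed

lemma associate_SomeD: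
  assumes "associate q p = Some r"
  shows "\<exists>k. q (2 * prod_encode (n, prefix_code p k))"
    and "r n = q (2 * prod_encode (n, prefix_code p
           (LEAST k. q (2 * prod_encode (n, prefix_code p k)))) + 1)"
proof -
  let ?P = "\<forall>n. \<exists>k. q (2 * prod_encode (n, prefix_code p k))"
  have P: ?P
  proof (rule ccontr)
    assume "\<not> ?P"
    with assms show False
      unfolding associate_def Let_def by (simp only: if_False option.distinct)
  qed
  then show "\<exists>k. q (2 * prod_encode (n, prefix_code p k))"
    by blast
  show "r n = q (2 * prod_encode (n, prefix_code p
           (LEAST k. q (2 * prod_encode (n, prefix_code p k)))) + 1)"
    using assms unfolding associate_def Let_def if_P[OF P] option.inject
    by (rule subst) (rule refl)
qed

lemma function_name_unique:
  assumes "function_name X Y q f" "function_name X Y q g"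
  shows "f = g"
proof (rule extensionalityI[of _ "ran X"])
  fix x assume "x \<in> ran X"
  then obtain p where "X p = Some x"
    by (auto simp: ran_def)
  with assms show "f x = g x"
    by (fastforce simp: function_name_def realizes_def)
qed (use assms in \<open>auto simp: function_name_def\<close>)

lemma function_rep_eq_Some: "function_rep X Y q = Some f \<longleftrightarrow> function_name X Y q f"
proof -
  have "(THE f. function_name X Y q f) = f" if "function_name X Y q f" for f
    by (rule the_equality[where P = "function_name X Y q", OF that])
       (rule function_name_unique[OF _ that])
  then show ?thesis
    unfolding function_rep_def by auto
qed

lemma prefix_code_bounds: "2 ^ k \<le> prefix_code p k \<and> prefix_code p k < 2 ^ Suc k"
  by (induction k) auto

lemma prefix_code_length:
  assumes "prefix_code p k = prefix_code p' k'"
  shows "k = k'"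
proof (rule ccontr)
  have *: "prefix_code r m < prefix_code s n" if "m < n" for r s :: cantor and m n
  proof -
    have "prefix_code r m < 2 ^ Suc m"
      using prefix_code_bounds by blast
    also have "\<dots> \<le> 2 ^ n"
      using that by (intro power_increasing) auto
    also have "\<dots> \<le> prefix_code s n"
      using prefix_code_bounds by blast
    finally show ?thesis .
  qed
  assume "k \<noteq> k'"
  then show False
    using *[of k k' p p'] *[of k' k p' p] assms by linarith
qed

lemma prefix_code_eq_iff: "prefix_code p k = prefix_code p' k \<longleftrightarrow> (\<forall>i<k. p i = p' i)"
proof (induction k)
  case (Suc k)
  have "2 * a + of_bool x = 2 * b + of_bool y \<longleftrightarrow> a = b \<and> x = y" for a b :: nat and x y
    by (cases x; cases y; simp; presburger)
  then show ?case
    by (simp add: Suc less_Suc_eq) blast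
qed auto

lemma open_cylinder: "open {p' :: cantor. \<forall>i<k. p' i = p i}"
proof -
  have "{p'. \<forall>i<k. p' i = p i} = (\<Inter>i\<in>{..<k}. (\<lambda>p'. p' i) -` {p i})"
    by auto
  also have "open \<dots>"
    by (intro open_INT finite_lessThan ballI open_vimage open_discrete
        continuous_on_product_coordinates)
  finally show ?thesis .
qed

lemma open_contains_cylinder:
  fixes W :: "cantor set"
  assumes "open W" "p \<in> W"
  obtains k where "{p'. \<forall>i<k. p' i = p i} \<subseteq> W"
proof -
  have "openin (product_topology (\<lambda>i. euclidean) UNIV) W"
    using assms(1) by (simp add: open_fun_def)
  from product_topology_open_contains_basis[OF this assms(2)]
  obtain B where B: "p \<in> (\<Pi>\<^sub>E i\<in>UNIV. B i)" "finite {i. B i \<noteq> topspace euclidean}"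
      "(\<Pi>\<^sub>E i\<in>UNIV. B i) \<subseteq> W"
    by blast
  obtain k where k: "{i. B i \<noteq> UNIV} \<subseteq> {..<k}"
    using finite_nat_iff_bounded B(2) by auto
  have "{p'. \<forall>i<k. p' i = p i} \<subseteq> (\<Pi>\<^sub>E i\<in>UNIV. B i)"
  proof (clarsimp simp: PiE_def)
    fix p' i assume "\<forall>i<k. p' i = p i"
    then show "p' i \<in> B i"
      using k B(1) by (cases "i < k") (auto simp: PiE_def Pi_def)
  qed
  then show thesis
    by (rule that[OF subset_trans[OF _ B(3)]])
qed

lemma open_rep_eq_Some:
  "open_rep X q = Some U \<longleftrightarrow>
     U \<subseteq> ran X \<and> function_name X sierpinski q (\<lambda>x\<in>ran X. x \<in> U)"
proof
  assume "open_rep X q = Some U"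
  then obtain f where f: "function_name X sierpinski q f" "U = {x \<in> ran X. f x}"
    by (auto simp: open_rep_def function_rep_eq_Some)
  then have "(\<lambda>x\<in>ran X. x \<in> U) = f"
    by (auto simp: function_name_def extensional_def restrict_def)
  with f show "U \<subseteq> ran X \<and> function_name X sierpinski q (\<lambda>x\<in>ran X. x \<in> U)"
    by auto
next
  assume *: "U \<subseteq> ran X \<and> function_name X sierpinski q (\<lambda>x\<in>ran X. x \<in> U)"
  then have "function_rep X sierpinski q = Some (\<lambda>x\<in>ran X. x \<in> U)"
    by (simp add: function_rep_eq_Some)
  with * show "open_rep X q = Some U"
    by (auto simp: open_rep_def)
qed

theorem ran_open_rep: "U \<in> ran (open_rep X) \<longleftrightarrow> openin (rtop X) U"
proof
  assume "U \<in> ran (open_rep X)"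
  then obtain q where U: "U \<subseteq> ran X"
    and q: "realizes (associate q) X sierpinski (\<lambda>x. Some (x \<in> ran X \<and> x \<in> U))"
    by (fastforce simp: ran_def[of "open_rep X"] open_rep_eq_Some function_name_def
        realizes_def ranI)
  have key: "\<exists>r. associate q p = Some r \<and> ((\<exists>n. r n) \<longleftrightarrow> x \<in> U)" if "X p = Some x" for p x
    using q that by (fastforce simp: realizes_def sierpinski_def ranI)
  have "\<exists>T. open T \<and> p \<in> T \<and> T \<inter> dom X \<subseteq> {p \<in> dom X. the (X p) \<in> U}"
    if p: "p \<in> dom X" "the (X p) \<in> U" for p
  proof -
    obtain x where "X p = Some x"
      using p by blast
    with key[OF this] p obtain r n where r: "associate q p = Some r" "r n"
      by auto
    define c where "c = (\<lambda>p k. prod_encode (n, prefix_code p k))"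
    define K where "K = (LEAST k. q (2 * c p k))"
    have K: "q (2 * c p K)" "q (2 * c p K + 1)"
      using LeastI_ex[OF associate_SomeD(1)[OF r(1), of n]] r(2)
      unfolding K_def c_def associate_SomeD(2)[OF r(1), of n] by simp_all
    have below: "\<not> q (2 * c p k)" if "k < K" for k
      using that not_less_Least unfolding K_def by blast
    have "the (X p') \<in> U" if p': "p' \<in> dom X" "\<forall>i<K. p' i = p i" for p'
    proof -
      have eq: "c p' k = c p k" if "k \<le> K" for k
        using p'(2) that by (auto simp: c_def prefix_code_eq_iff)
      have "(LEAST k. q (2 * c p' k)) = K"
      proof (rule Least_equality)
        show "q (2 * c p' K)"
          using K eq by simp
        show "K \<le> k" if "q (2 * c p' k)" for k
          using that below[of k] eq[of k] by (metis linorder_not_le less_imp_le)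
      qed
      moreover obtain x' where x': "X p' = Some x'"
        using p'(1) by blast
      then obtain r' where r': "associate q p' = Some r'" "(\<exists>n. r' n) \<longleftrightarrow> the (X p') \<in> U"
        using key[OF x'] by auto
      ultimately have "r' n"
        using K(2) eq[of K] unfolding associate_SomeD(2)[OF r'(1)] c_def by simp
      with r' show ?thesis
        by blast
    qed
    then show ?thesis
      using open_cylinder[of K p]
      by (intro exI[of _ "{p'. \<forall>i<K. p' i = p i}"]) auto
  qed
  then have "openin (top_of_set (dom X)) {p \<in> dom X. the (X p) \<in> U}"
    unfolding openin_subopen[of _ "{p \<in> dom X. the (X p) \<in> U}"] openin_open
    by (smt (verit) Int_commute Int_iff mem_Collect_eq)
  with U show "openin (rtop X) U"
    by (simp add: openin_rtop)
next
  assume "openin (rtop X) U"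
  then obtain W where U: "U \<subseteq> ran X" and W: "open W"
    "{p \<in> dom X. the (X p) \<in> U} = dom X \<inter> W"
    by (auto simp: openin_rtop openin_open)
  define q :: cantor where "q = (\<lambda>m. case prod_decode (m div 2) of (n, w) \<Rightarrow>
     if even m then \<exists>p. w = prefix_code p n else \<forall>p. w = prefix_code p n \<longrightarrow> p \<in> W)"
  have halt: "q (2 * prod_encode (n, prefix_code p k)) \<longleftrightarrow> k = n" for n p k
    by (auto simp: q_def dest: prefix_code_length)
  have assoc: "associate q p = Some (\<lambda>n. \<forall>p'. (\<forall>i<n. p i = p' i) \<longrightarrow> p' \<in> W)" for p
  proof -
    have "(LEAST k. k = n) = n" for n :: nat
      by (rule Least_equality) auto
    then show ?thesis
      by (simp add: associate_def halt Let_def) (simp add: q_def prefix_code_eq_iff)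
  qed
  have "(\<exists>n. \<forall>p'. (\<forall>i<n. p i = p' i) \<longrightarrow> p' \<in> W) \<longleftrightarrow> p \<in> W" for p
  proof
    assume "p \<in> W"
    from open_contains_cylinder[OF W(1) this] obtain k where
      "{p'. \<forall>i<k. p' i = p i} \<subseteq> W" .
    then show "\<exists>n. \<forall>p'. (\<forall>i<n. p i = p' i) \<longrightarrow> p' \<in> W"
      by (intro exI[of _ k]) auto
  qed auto
  moreover have "p \<in> W \<longleftrightarrow> x \<in> U" if "X p = Some x" for p x
    using W(2) that by force
  ultimately have "function_name X sierpinski q (\<lambda>x\<in>ran X. x \<in> U)"
    by (simp add: function_name_def realizes_def assoc sierpinski_def ranI)
  with U have "open_rep X q = Some U"
    by (simp add: open_rep_eq_Some)
  then show "U \<in> ran (open_rep X)"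
    by (auto simp: ran_def)
qed

lemma compact_name_unique:
  assumes "compact_name X q A" "compact_name X q B"
  shows "A = B"
proof -
  have "{U. openin (rtop X) U \<and> A \<subseteq> U} = {U. openin (rtop X) U \<and> B \<subseteq> U}"
    using assms by (simp add: compact_name_def ran_open_rep)
  then show ?thesis
    using assms by (metis compact_name_def)
qed

lemma compact_rep_eq_Some: "compact_rep X q = Some A \<longleftrightarrow> compact_name X q A"
proof -
  have "(THE A. compact_name X q A) = A" if "compact_name X q A" for A
    using that by (rule the_equality) (rule compact_name_unique[OF _ that])
  then show ?thesis
    unfolding compact_rep_def by auto
qed

end

theory Submission
  imports Defs
begin

text \<open>
  Enumerate the basic open cells \<open>S(e\<^sub>m)\<close>. In the new representation \<open>\<delta>\<close>, the even bits of \<open>q\<close> form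
  an \<open>X\<close>-name of \<open>x\<close>, and a zero at \<open>2m + 1\<close> asserts that \<open>x \<notin> S(e\<^sub>m)\<close>; a one asserts nothing, so
  \<open>\<delta>\<close> is equivalent to the given representation. Dually, \<open>\<psi>\<close> is defined on sequences that are
  \<open>\<bottom>\<close> at even positions, and \<open>\<psi>(p)\<close> is the complement of the union of the cells \<open>S(e\<^sub>m)\<close> with
  \<open>p(2m + 1) = 0\<close>. Then \<open>p\<close> has a total refinement naming \<open>x\<close> iff \<open>x \<in> \<psi>(p)\<close>.

  From \<open>p\<close> one gets a compact name of \<open>A = \<psi>(p)\<close>, since \<open>A \<subseteq> U\<close> iff \<open>U\<close> and the cells excluded by \<open>p\<close>
  cover \<open>X\<close>, which computable compactness makes semidecidable. Conversely, given \<open>A\<close>, put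
  \<open>p(2m + 1) = 0\<close> as soon as \<open>A\<close> is found to lie in the union of the sets \<open>S\<^bsub>k,1-e(k)\<^esub>\<close>, \<open>e = e\<^sub>m\<close>. As \<open>S\<close> is
  proper, this union is the exterior of the cell, and in a Hausdorff space the cells whose closure
  misses the compact set \<open>A\<close> cover the complement of \<open>A\<close>.
\<close>

section \<open>Total recursive functions relative to an oracle\<close>

abbreviation lproj :: "nat \<Rightarrow> nat" where
  "lproj c \<equiv> fst (prod_decode c)"

abbreviation rproj :: "nat \<Rightarrow> nat" where
  "rproj c \<equiv> snd (prod_decode c)"

definition total_recursive :: "(cantor \<Rightarrow> nat \<Rightarrow> nat) \<Rightarrow> bool" where
  "total_recursive f \<longleftrightarrow> partial_recursive (\<lambda>p n. Some (f p n))"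

definition recursive_pred :: "(cantor \<Rightarrow> nat \<Rightarrow> bool) \<Rightarrow> bool" where
  "recursive_pred P \<longleftrightarrow> total_recursive (\<lambda>p n. of_bool (P p n))"

text \<open>One rule for each term former, so that a goal is settled by following its
  syntax.\<close>

named_theorems recursive_intros

lemma total_recursive_Suc_id: "total_recursive (\<lambda>p. Suc)"
  unfolding total_recursive_def by (rule pr_succ)

lemma total_recursive_lproj_id: "total_recursive (\<lambda>p. lproj)"
  unfolding total_recursive_def by (rule pr_fst)

lemma total_recursive_rproj_id: "total_recursive (\<lambda>p. rproj)"
  unfolding total_recursive_def by (rule pr_snd)

lemma total_recursive_comp:
  assumes "total_recursive f" "total_recursive g"
  shows "total_recursive (\<lambda>p n. f p (g p n))"
  using pr_comp[OF assms[unfolded total_recursive_def]] by (simp add: total_recursive_def)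

lemma total_recursive_pair [recursive_intros]:
  assumes "total_recursive f" "total_recursive g"
  shows "total_recursive (\<lambda>p n. prod_encode (f p n, g p n))"
  using pr_pair[OF assms[unfolded total_recursive_def]] by (simp add: total_recursive_def)

text \<open>The identity is not an initial function; it is recovered by pairing the two
  projections.\<close>

lemma total_recursive_id [recursive_intros]: "total_recursive (\<lambda>p n. n)"
  using total_recursive_pair[OF total_recursive_lproj_id total_recursive_rproj_id] by simp

lemma total_recursive_const [recursive_intros]: "total_recursive (\<lambda>p n. k)"
proof (induction k)
  case 0
  show ?case
    unfolding total_recursive_def by (rule pr_zero)
next
  case (Suc k)
  from total_recursive_comp[OF total_recursive_Suc_id this] show ?case .
qed

lemmas total_recursive_Suc [recursive_intros] = total_recursive_comp[OF total_recursive_Suc_id]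
lemmas total_recursive_lproj [recursive_intros] = total_recursive_comp[OF total_recursive_lproj_id]
lemmas total_recursive_rproj [recursive_intros] = total_recursive_comp[OF total_recursive_rproj_id]

text \<open>\<open>pr_rec\<close> takes parameter and recursion argument as one pair. Here the whole
  input \<open>n\<close> serves as the parameter, so it stays available to the base and the step;
  the step reads the triple <n, <k, v>>.\<close>

lemma total_recursive_rec [recursive_intros]:
  assumes "total_recursive f"
    and "total_recursive (\<lambda>p c. g p (lproj c) (lproj (rproj c)) (rproj (rproj c)))"
    and "total_recursive h"
  shows "total_recursive (\<lambda>p n. rec_nat (f p n) (g p n) (h p n))"
proof -
  have "rec_nat (Some (f p a))
      (\<lambda>k r. Option.bind r (\<lambda>v. Some (g p (lproj (prod_encode (a, prod_encode (k, v))))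
        (lproj (rproj (prod_encode (a, prod_encode (k, v)))))
        (rproj (rproj (prod_encode (a, prod_encode (k, v)))))))) n =
     Some (rec_nat (f p a) (g p a) n)" for p a n
    by (induction n) simp_all
  with pr_rec[OF assms(1,2)[unfolded total_recursive_def]]
  have "total_recursive (\<lambda>p c. rec_nat (f p (lproj c)) (g p (lproj c)) (rproj c))"
    by (simp add: total_recursive_def case_prod_unfold)
  from total_recursive_comp[OF this total_recursive_pair[OF total_recursive_id assms(3)]]
  show ?thesis
    by simp
qed

section \<open>Arithmetic by primitive recursion\<close>

lemma total_recursive_add [recursive_intros]:
  assumes "total_recursive f" "total_recursive g"
  shows "total_recursive (\<lambda>p n. f p n + g p n)"
proof -
  have "a + b = rec_nat a (\<lambda>_. Suc) b" for a b
    by (induction b) auto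
  then show ?thesis
    by (simp only:) (intro recursive_intros assms)
qed

lemma total_recursive_mult [recursive_intros]:
  assumes "total_recursive f" "total_recursive g"
  shows "total_recursive (\<lambda>p n. f p n * g p n)"
proof -
  have "a * b = rec_nat 0 (\<lambda>_ v. v + a) b" for a b
    by (induction b) auto
  then show ?thesis
    \<comment> \<open>The step function uses \<open>f\<close>, which must be evaluated at the
      parameter part of its argument.\<close>
    by (simp only:) (intro recursive_intros total_recursive_comp[OF assms(1)] assms)
qed

lemma total_recursive_diff [recursive_intros]:
  assumes "total_recursive f" "total_recursive g"
  shows "total_recursive (\<lambda>p n. f p n - g p n)"
proof -
  have pred: "total_recursive (\<lambda>p n. h p n - 1)" if "total_recursive h" for h
  proof -
    have "a - 1 = rec_nat 0 (\<lambda>k _. k) a" for a :: nat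
      by (cases a) auto
    then show ?thesis
      by (simp only:) (intro recursive_intros that)
  qed
  have "a - b = rec_nat a (\<lambda>_ v. v - 1) b" for a b :: nat
    by (induction b) auto
  then have "(\<lambda>p n. f p n - g p n) = (\<lambda>p n. rec_nat (f p n) (\<lambda>_ v. v - 1) (g p n))"
    by (intro ext)
  then show ?thesis
    by (simp only:) (intro recursive_intros pred assms)
qed

section \<open>Decidable predicates\<close>

lemma total_recursive_of_bool [recursive_intros]:
  "recursive_pred P \<Longrightarrow> total_recursive (\<lambda>p n. of_bool (P p n))"
  by (simp add: recursive_pred_def)

lemma recursive_pred_comp:
  assumes "recursive_pred P" "total_recursive g"
  shows "recursive_pred (\<lambda>p n. P p (g p n))"
  using total_recursive_comp[OF assms[unfolded recursive_pred_def]] by (simp add: recursive_pred_def)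

lemma recursive_pred_oracle [recursive_intros]:
  assumes "total_recursive g"
  shows "recursive_pred (\<lambda>p n. p (g p n))"
proof (rule recursive_pred_comp[OF _ assms])
  show "recursive_pred (\<lambda>p. p)"
    unfolding recursive_pred_def total_recursive_def by (rule pr_oracle)
qed

lemma recursive_pred_const [recursive_intros]: "recursive_pred (\<lambda>p n. b)"
  unfolding recursive_pred_def by (rule total_recursive_const)

lemma recursive_pred_not [recursive_intros]:
  assumes "recursive_pred P"
  shows "recursive_pred (\<lambda>p n. \<not> P p n)"
proof -
  have "of_bool (\<not> b) = 1 - (of_bool b :: nat)" for b
    by simp
  then show ?thesis
    unfolding recursive_pred_def by (simp only:) (intro recursive_intros assms)
qed

lemma recursive_pred_conj [recursive_intros]:
  assumes "recursive_pred P" "recursive_pred Q"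
  shows "recursive_pred (\<lambda>p n. P p n \<and> Q p n)"
  unfolding recursive_pred_def of_bool_conj by (intro recursive_intros assms)

lemma recursive_pred_disj [recursive_intros]:
  assumes "recursive_pred P" "recursive_pred Q"
  shows "recursive_pred (\<lambda>p n. P p n \<or> Q p n)"
proof -
  have "recursive_pred (\<lambda>p n. \<not> (\<not> P p n \<and> \<not> Q p n))"
    by (intro recursive_intros assms)
  then show ?thesis
    by simp
qed

lemma recursive_pred_imp [recursive_intros]:
  assumes "recursive_pred P" "recursive_pred Q"
  shows "recursive_pred (\<lambda>p n. P p n \<longrightarrow> Q p n)"
  unfolding imp_conv_disj by (intro recursive_intros assms)

lemma recursive_pred_iff [recursive_intros]:
  assumes "recursive_pred P" "recursive_pred Q"
  shows "recursive_pred (\<lambda>p n. P p n = Q p n)"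
  unfolding iff_conv_conj_imp by (intro recursive_intros assms)

lemma recursive_pred_le [recursive_intros]:
  assumes "total_recursive f" "total_recursive g"
  shows "recursive_pred (\<lambda>p n. f p n \<le> g p n)"
proof -
  have "of_bool (a \<le> b) = 1 - (a - b)" for a b :: nat
    by auto
  then show ?thesis
    unfolding recursive_pred_def by (simp only:) (intro recursive_intros assms)
qed

lemma recursive_pred_eq [recursive_intros]:
  assumes "total_recursive f" "total_recursive g"
  shows "recursive_pred (\<lambda>p n. f p n = g p n)"
  unfolding eq_iff by (intro recursive_intros assms)

lemma total_recursive_if [recursive_intros]:
  assumes "recursive_pred P" "total_recursive f" "total_recursive g"
  shows "total_recursive (\<lambda>p n. if P p n then f p n else g p n)"
proof -
  have "(if b then x else y) = of_bool b * x + of_bool (\<not> b) * y" for b and x y :: nat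
    by simp
  then show ?thesis
    by (simp only:) (intro recursive_intros assms)
qed

lemma recursive_pred_if [recursive_intros]:
  assumes "recursive_pred P" "recursive_pred Q" "recursive_pred R"
  shows "recursive_pred (\<lambda>p n. if P p n then Q p n else R p n)"
  unfolding if_bool_eq_conj by (intro recursive_intros assms)

lemma recursive_pred_ex_less [recursive_intros]:
  assumes "recursive_pred (\<lambda>p c. P p (lproj c) (rproj c))" "total_recursive b"
  shows "recursive_pred (\<lambda>p n. \<exists>k<b p n. P p n k)"
proof -
  have "(of_bool (\<exists>k<b. Q k) :: nat) = rec_nat 0 (\<lambda>k v. of_bool (Q k \<or> v = 1)) b" for b and Q
  proof (induction b)
    case (Suc b)
    let ?r = "rec_nat (0::nat) (\<lambda>k v. of_bool (Q k \<or> v = 1))"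
    have "?r (Suc b) = of_bool (Q b \<or> ?r b = 1)"
      by simp
    also have "\<dots> = of_bool (\<exists>k<Suc b. Q k)"
      unfolding Suc[symmetric] by (auto simp: less_Suc_eq)
    finally show ?case ..
  qed simp
  \<comment> \<open>The step function receives <n, <k, v>>, whereas \<open>P\<close> is given on
    pairs <n, k>.\<close>
  moreover have "recursive_pred (\<lambda>p c. P p (lproj c) (lproj (rproj c)))"
    using recursive_pred_comp[OF assms(1),
        of "\<lambda>p c. prod_encode (lproj c, lproj (rproj c))"]
    by (simp add: recursive_intros)
  ultimately show ?thesis
    unfolding recursive_pred_def
    by (simp only:) (intro recursive_intros assms; simp add: recursive_pred_def)
qed

lemma recursive_pred_all_less [recursive_intros]:
  assumes "recursive_pred (\<lambda>p c. P p (lproj c) (rproj c))" "total_recursive b"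
  shows "recursive_pred (\<lambda>p n. \<forall>k<b p n. P p n k)"
proof -
  have "recursive_pred (\<lambda>p n. \<not> (\<exists>k<b p n. \<not> P p n k))"
    by (intro recursive_intros assms)
  then show ?thesis
    by simp
qed

lemma recursive_pred_odd [recursive_intros]:
  assumes "total_recursive f"
  shows "recursive_pred (\<lambda>p n. odd (f p n))"
proof -
  have "(of_bool (odd a) :: nat) = rec_nat 0 (\<lambda>_ v. 1 - v) a" for a :: nat
    by (induction a) auto
  then show ?thesis
    unfolding recursive_pred_def by (simp only:) (intro recursive_intros assms)
qed

lemma recursive_pred_even [recursive_intros]:
  assumes "total_recursive f"
  shows "recursive_pred (\<lambda>p n. even (f p n))"
  using recursive_pred_not[OF recursive_pred_odd[OF assms]] by simp

lemma total_recursive_div2 [recursive_intros]: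
  assumes "total_recursive f"
  shows "total_recursive (\<lambda>p n. f p n div 2)"
proof -
  have "a div 2 = rec_nat 0 (\<lambda>k v. v + of_bool (odd k)) a" for a :: nat
  proof (induction a)
    case (Suc a)
    have "Suc a div 2 = a div 2 + of_bool (odd a)"
      by (cases "odd a") (auto elim!: oddE evenE)
    with Suc show ?case
      by simp
  qed auto
  then show ?thesis
    by (simp only:) (intro recursive_intros assms)
qed

lemma total_recursive_div_power2 [recursive_intros]:
  assumes "total_recursive f" "total_recursive g"
  shows "total_recursive (\<lambda>p n. f p n div 2 ^ g p n)"
proof -
  have "a div 2 ^ b = rec_nat a (\<lambda>_ v. v div 2) b" for a b :: nat
    by (induction b) (auto simp: div_mult2_eq power_Suc2 simp del: power_Suc)
  then show ?thesis
    by (simp only:) (intro recursive_intros assms)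
qed

lemma total_recursive_prefix_code [recursive_intros]:
  assumes "recursive_pred (\<lambda>p c. q p (lproj c) (rproj c))" "total_recursive h"
  shows "total_recursive (\<lambda>p n. prefix_code (q p n) (h p n))"
proof -
  have "prefix_code r k = rec_nat 1 (\<lambda>k v. 2 * v + of_bool (r k)) k" for r k
    by (induction k) auto
  moreover have "recursive_pred (\<lambda>p c. q p (lproj c) (lproj (rproj c)))"
    using recursive_pred_comp[OF assms(1),
        of "\<lambda>p c. prod_encode (lproj c, lproj (rproj c))"]
    by (simp add: recursive_intros)
  ultimately show ?thesis
    by (simp only:) (intro recursive_intros assms; simp add: recursive_pred_def)
qed


text \<open>The oracle may depend on a number \<open>a\<close>, which is passed along with the argument.\<close>

lemma partial_recursive_oracle_subst:
  assumes "partial_recursive \<Phi>" and C: "recursive_pred C"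
  shows "partial_recursive (\<lambda>t c. \<Phi> (\<lambda>m. C t (prod_encode (lproj c, m))) (rproj c))"
  using assms(1)
proof induction
  case (pr_pair f g)
  from pr_pair.IH show ?case
    by (rule partial_recursive.pr_pair)
next
  case (pr_comp f g)
  \<comment> \<open>The inner result is paired with the oracle parameter again, so that the outer
    functional runs with the same oracle.\<close>
  from partial_recursive.pr_comp[OF pr_comp.IH(1) partial_recursive.pr_pair[OF pr_fst pr_comp.IH(2)]]
  show ?case
    by (simp add: bind_assoc)
next
  case (pr_rec f g)
  let ?O = "\<lambda>t a m. C t (prod_encode (a, m))"
  \<comment> \<open>The parameter of the recursion is <a, b>, with \<open>a\<close> for the oracle;
    <<a, b>, <k, v>> is regrouped so that \<open>a\<close> stands alone on the left.\<close>
  have "partial_recursive (\<lambda>t c. Some (prod_encode (lproj (lproj c),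
      prod_encode (rproj (lproj c), rproj c))))"
    unfolding total_recursive_def[symmetric] by (intro recursive_intros)
  from partial_recursive.pr_rec[OF pr_rec.IH(1) partial_recursive.pr_comp[OF pr_rec.IH(2) this]]
  have *: "partial_recursive (\<lambda>t c. rec_nat (f (?O t (lproj (lproj c))) (rproj (lproj c)))
     (\<lambda>k r. Option.bind r (\<lambda>v. g (?O t (lproj (lproj c)))
        (prod_encode (rproj (lproj c), prod_encode (k, v))))) (rproj c))"
    by (simp add: case_prod_unfold)
  have "partial_recursive (\<lambda>t c. Some (prod_encode (prod_encode (lproj c, lproj (rproj c)),
      rproj (rproj c))))"
    unfolding total_recursive_def[symmetric] by (intro recursive_intros)
  from partial_recursive.pr_comp[OF * this] show ?case
    by (simp add: case_prod_unfold)
next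
  case (pr_min f)
  have "partial_recursive (\<lambda>t c. Some (prod_encode (lproj (lproj c),
      prod_encode (rproj (lproj c), rproj c))))"
    unfolding total_recursive_def[symmetric] by (intro recursive_intros)
  from partial_recursive.pr_min[OF partial_recursive.pr_comp[OF pr_min.IH this]]
  show ?case
    by simp
qed (unfold total_recursive_def[symmetric] prod.collapse prod_decode_inverse;
    intro recursive_intros C)+

text \<open>Runs a computable realizer on a recursively indexed family of names, all indices at
  once: the outputs form a single recursive predicate.\<close>

lemma recursive_pred_oracle_subst:
  assumes "partial_recursive \<Phi>" "recursive_pred C"
    and "\<And>t c. \<Phi> (\<lambda>m. C t (prod_encode (lproj c, m))) (rproj c) = Some (of_bool (P t c))"
  shows "recursive_pred P"
  using partial_recursive_oracle_subst[OF assms(1,2)]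
  by (simp add: assms(3) recursive_pred_def total_recursive_def)


section \<open>Simulation on finite prefixes and currying\<close>

text \<open>One oracle for a parameter \<open>t\<close> and an argument \<open>u\<close>,
  interleaved as in \<open>prod_rep\<close>.\<close>

definition join :: "cantor \<Rightarrow> cantor \<Rightarrow> cantor" where
  "join t u n = (if even n then t (n div 2) else u (n div 2))"

lemma join_simps [simp]: "join t u (2 * n) = t n" "join t u (2 * n + 1) = u n"
    "join t u (Suc (2 * n)) = u n"
  by (auto simp: join_def)

lemma le_prefix_code: "k \<le> prefix_code u k"
  using prefix_code_bounds[of k u] less_exp[of k] by linarith

text \<open>Halving a code deletes the last letter of the word.\<close>

lemma prefix_code_div_power2: "i \<le> k \<Longrightarrow> prefix_code u k div 2 ^ i = prefix_code u (k - i)"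
proof (induction i)
  case (Suc i)
  then have "prefix_code u k div 2 ^ Suc i = prefix_code u (Suc (k - Suc i)) div 2"
    by (simp add: div_mult2_eq power_Suc2 Suc_diff_Suc del: power_Suc prefix_code.simps)
  then show ?case
    by simp
qed simp

text \<open>The empty word has code \<open>1\<close>, so the number of halvings that lead to
  \<open>1\<close> is the length.\<close>

lemma prefix_code_div_power2_eq_1: "prefix_code u k div 2 ^ j = 1 \<longleftrightarrow> k = j"
proof
  assume *: "prefix_code u k div 2 ^ j = 1"
  then have "2 ^ j \<le> prefix_code u k"
    by (metis div_less not_le zero_neq_one)
  moreover have "prefix_code u k < 2 ^ Suc j"
    using * div_less_iff_less_mult[of "2 ^ j" "prefix_code u k" 2] by simp
  ultimately have "(2::nat) ^ j < 2 ^ Suc k" "(2::nat) ^ k < 2 ^ Suc j"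
    using prefix_code_bounds[of k u] by linarith+
  then have "j < Suc k" "k < Suc j"
    by (simp_all only: power_strict_increasing_iff one_less_numeral_iff semiring_norm)
  then show "k = j"
    by simp
next
  assume "k = j"
  then show "prefix_code u k div 2 ^ j = 1"
    using prefix_code_div_power2[of k k u] by simp
qed

text \<open>Reads \<open>u(j) = b\<close> off the code of a prefix of \<open>u\<close>.\<close>

definition code_bit :: "nat \<Rightarrow> nat \<Rightarrow> bool \<Rightarrow> bool" where
  "code_bit w j b \<longleftrightarrow> (\<exists>i<w. w div 2 ^ i div 2 ^ Suc j = 1 \<and> odd (w div 2 ^ i) = b)"

text \<open>Shifting by \<open>i\<close> leaves the code of a shorter prefix. The test against
  \<open>1\<close> forces its length to be \<open>Suc j\<close>, and then its parity is the letter
  \<open>u j\<close>.\<close>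

lemma code_bit_prefix_code: "code_bit (prefix_code u k) j b \<longleftrightarrow> j < k \<and> u j = b"
proof
  assume "code_bit (prefix_code u k) j b"
  then obtain i where i: "prefix_code u k div 2 ^ i div 2 ^ Suc j = 1"
      "odd (prefix_code u k div 2 ^ i) = b"
    by (auto simp: code_bit_def)
  have "i \<le> k"
  proof (rule ccontr)
    assume "\<not> i \<le> k"
    then have "prefix_code u k < 2 ^ i"
      using prefix_code_bounds[of k u] power_increasing[of "Suc k" i "2::nat"] by linarith
    with i(1) show False
      by simp
  qed
  with i prefix_code_div_power2_eq_1[of u "k - i" "Suc j"] have "k - i = Suc j"
    by (simp only: prefix_code_div_power2)
  with i \<open>i \<le> k\<close> show "j < k \<and> u j = b"
    by (auto simp: prefix_code_div_power2)
next
  assume *: "j < k \<and> u j = b"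
  then have "prefix_code u k div 2 ^ (k - Suc j) = prefix_code u (Suc j)"
    by (simp add: prefix_code_div_power2 del: prefix_code.simps)
  \<comment> \<open>A code is at least as large as the length of its word, so the bounded search in
    \<open>code_bit\<close> reaches this shift.\<close>
  moreover have "k - Suc j < prefix_code u k"
    using * le_prefix_code[of k u] by linarith
  ultimately show "code_bit (prefix_code u k) j b"
    using * prefix_code_div_power2_eq_1[of u "Suc j" "Suc j"]
    unfolding code_bit_def by (intro exI[of _ "k - Suc j"]) (simp del: power_Suc)
qed

lemma recursive_pred_code_bit [recursive_intros]:
  assumes "total_recursive f" "total_recursive g"
  shows "recursive_pred (\<lambda>p n. code_bit (f p n) (g p n) b)"
  unfolding code_bit_def
  by (intro recursive_intros total_recursive_comp[OF assms(1)] total_recursive_comp[OF assms(2)] assms)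

section \<open>Approximating partial recursive functionals\<close>

lemma minimize_eq_Some:
  "minimize g = Some m \<longleftrightarrow> g m = Some 0 \<and> (\<forall>j<m. \<exists>v. g j = Some (Suc v))"
proof -
  have *: "(LEAST n. g n = Some 0) = n" if "g n = Some 0" "\<forall>j<n. \<exists>v. g j = Some (Suc v)" for n
    using that by (intro Least_equality) (auto simp: not_less[symmetric])
  then show ?thesis
    unfolding minimize_def by auto
qed

text \<open>
  \<open>\<Psi>\<close> approximates \<open>\<Phi>\<close> using only a prefix of the second half of the oracle; the length of that
  prefix also bounds the running time. The value \<open>0\<close> means that no result has been found yet.
\<close>

definition simulates :: "(cantor \<Rightarrow> nat \<Rightarrow> nat) \<Rightarrow> (cantor \<Rightarrow> nat \<Rightarrow> nat option) \<Rightarrow> bool" where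
  "simulates \<Psi> \<Phi> \<longleftrightarrow> total_recursive \<Psi> \<and>
     (\<forall>t u n v k. \<Psi> t (prod_encode (n, prefix_code u k)) = Suc v \<longrightarrow> \<Phi> (join t u) n = Some v) \<and>
     (\<forall>t u n v. \<Phi> (join t u) n = Some v \<longrightarrow>
        (\<forall>\<^sub>F k in sequentially. \<Psi> t (prod_encode (n, prefix_code u k)) = Suc v))"

lemma simulatesI:
  assumes "total_recursive \<Psi>"
    and "\<And>t u n v k. \<Psi> t (prod_encode (n, prefix_code u k)) = Suc v \<Longrightarrow> \<Phi> (join t u) n = Some v"
    and "\<And>t u n v. \<Phi> (join t u) n = Some v \<Longrightarrow>
        \<forall>\<^sub>F k in sequentially. \<Psi> t (prod_encode (n, prefix_code u k)) = Suc v"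
  shows "simulates \<Psi> \<Phi>"
  using assms by (auto simp: simulates_def)

lemma simulatesD:
  assumes "simulates \<Psi> \<Phi>"
  shows "total_recursive \<Psi>"
    and "\<Psi> t (prod_encode (n, prefix_code u k)) = Suc v \<Longrightarrow> \<Phi> (join t u) n = Some v"
    and "\<Phi> (join t u) n = Some v \<Longrightarrow>
        \<forall>\<^sub>F k in sequentially. \<Psi> t (prod_encode (n, prefix_code u k)) = Suc v"
  using assms unfolding simulates_def by blast+

lemma simulates_total:
  assumes "total_recursive (\<lambda>p. f)"
  shows "simulates (\<lambda>t c. Suc (f (lproj c))) (\<lambda>p n. Some (f n))"
  by (rule simulatesI) (auto intro!: recursive_intros total_recursive_comp[OF assms])

text \<open>Bits of \<open>t\<close> are asked from the oracle itself, bits of \<open>u\<close> are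
  read off the prefix code. If the prefix is too short, neither test succeeds and the answer is
  \<open>0\<close>.\<close>

lemma simulates_oracle:
  "simulates (\<lambda>t c. if even (lproj c) then Suc (of_bool (t (lproj c div 2)))
      else if code_bit (rproj c) (lproj c div 2) True then Suc 1
      else if code_bit (rproj c) (lproj c div 2) False then 1 else 0) (\<lambda>p n. Some (of_bool (p n)))"
    (is "simulates ?\<Psi> _")
proof (rule simulatesI)
  show "total_recursive ?\<Psi>"
    by (intro recursive_intros)
next
  fix t u n v k assume "?\<Psi> t (prod_encode (n, prefix_code u k)) = Suc v"
  then show "Some (of_bool (join t u n)) = Some v"
    by (auto simp: join_def code_bit_prefix_code split: if_splits)
next
  fix t u n and v :: nat assume "Some (of_bool (join t u n)) = Some v"
  then show "\<forall>\<^sub>F k in sequentially. ?\<Psi> t (prod_encode (n, prefix_code u k)) = Suc v"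
    by (intro eventually_mono[OF eventually_gt_at_top[of "n div 2"]])
       (auto simp: join_def code_bit_prefix_code)
qed

text \<open>Where both functionals converge, both approximations are right on all sufficiently long
  prefixes, hence jointly so.\<close>

lemma simulates_pair:
  assumes "simulates F f" "simulates G g"
  shows "simulates (\<lambda>t c. if F t c = 0 \<or> G t c = 0 then 0 else Suc (prod_encode (F t c - 1, G t c - 1)))
    (\<lambda>p n. Option.bind (f p n) (\<lambda>a. Option.bind (g p n) (\<lambda>b. Some (prod_encode (a, b)))))"
    (is "simulates ?\<Psi> ?\<Phi>")
proof (rule simulatesI)
  show "total_recursive ?\<Psi>"
    by (intro recursive_intros simulatesD(1)[OF assms(1)] simulatesD(1)[OF assms(2)])
next
  fix t u n v k assume "?\<Psi> t (prod_encode (n, prefix_code u k)) = Suc v"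
  then obtain a b where ab: "F t (prod_encode (n, prefix_code u k)) = Suc a"
      "G t (prod_encode (n, prefix_code u k)) = Suc b" "v = prod_encode (a, b)"
    by (cases "F t (prod_encode (n, prefix_code u k))";
        cases "G t (prod_encode (n, prefix_code u k))") auto
  then show "?\<Phi> (join t u) n = Some v"
    using simulatesD(2)[OF assms(1) ab(1)] simulatesD(2)[OF assms(2) ab(2)] by simp
next
  fix t u n v assume "?\<Phi> (join t u) n = Some v"
  then obtain a b where ab: "f (join t u) n = Some a" "g (join t u) n = Some b" "v = prod_encode (a, b)"
    by (auto simp: bind_eq_Some_conv)
  from simulatesD(3)[OF assms(1) ab(1)] simulatesD(3)[OF assms(2) ab(2)]
  show "\<forall>\<^sub>F k in sequentially. ?\<Psi> t (prod_encode (n, prefix_code u k)) = Suc v"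
    by eventually_elim (simp add: ab)
qed

lemma simulates_comp:
  assumes "simulates F f" "simulates G g"
  shows "simulates (\<lambda>t c. if G t c = 0 then 0 else F t (prod_encode (G t c - 1, rproj c)))
    (\<lambda>p n. Option.bind (g p n) (f p))"
    (is "simulates ?\<Psi> ?\<Phi>")
proof (rule simulatesI)
  show "total_recursive ?\<Psi>"
    by (intro recursive_intros simulatesD(1)[OF assms(2)]
        total_recursive_comp[OF simulatesD(1)[OF assms(1)]])
next
  fix t u n v k assume *: "?\<Psi> t (prod_encode (n, prefix_code u k)) = Suc v"
  then obtain a where a: "G t (prod_encode (n, prefix_code u k)) = Suc a"
    by (cases "G t (prod_encode (n, prefix_code u k))") auto
  with * have "F t (prod_encode (a, prefix_code u k)) = Suc v"
    by simp
  from simulatesD(2)[OF assms(1) this] simulatesD(2)[OF assms(2) a]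
  show "?\<Phi> (join t u) n = Some v"
    by simp
next
  fix t u n v assume "?\<Phi> (join t u) n = Some v"
  then obtain a where a: "g (join t u) n = Some a" "f (join t u) a = Some v"
    by (auto simp: bind_eq_Some_conv)
  from simulatesD(3)[OF assms(1) a(2)] simulatesD(3)[OF assms(2) a(1)]
  show "\<forall>\<^sub>F k in sequentially. ?\<Psi> t (prod_encode (n, prefix_code u k)) = Suc v"
    by eventually_elim simp
qed

text \<open>A missing result \<open>0\<close> is passed on through the remaining steps. Each step
  has its own threshold for the prefix length, and the induction on the recursion argument combines
  these finitely many thresholds.\<close>

lemma simulates_rec:
  assumes "simulates F f" "simulates G g"
  shows "simulates (\<lambda>t c. rec_nat (F t (prod_encode (lproj (lproj c), rproj c)))
      (\<lambda>k r. if r = 0 then 0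
         else G t (prod_encode (prod_encode (lproj (lproj c), prod_encode (k, r - 1)), rproj c)))
      (rproj (lproj c)))
    (\<lambda>p c. case prod_decode c of (a, n) \<Rightarrow>
      rec_nat (f p a) (\<lambda>k r. Option.bind r (\<lambda>v. g p (prod_encode (a, prod_encode (k, v))))) n)"
    (is "simulates ?\<Psi> ?\<Phi>")
proof -
  define \<Psi> \<Phi> where "\<Psi> = ?\<Psi>" and "\<Phi> = ?\<Phi>"
  have \<Psi>_simps: "\<Psi> t (prod_encode (prod_encode (a, 0), w)) = F t (prod_encode (a, w))"
      "\<Psi> t (prod_encode (prod_encode (a, Suc n), w)) =
        (let r = \<Psi> t (prod_encode (prod_encode (a, n), w))
         in if r = 0 then 0 else G t (prod_encode (prod_encode (a, prod_encode (n, r - 1)), w)))"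
    for t a n w
    by (simp_all add: \<Psi>_def Let_def cong del: if_weak_cong)
  have \<Phi>_simps: "\<Phi> p (prod_encode (a, 0)) = f p a"
      "\<Phi> p (prod_encode (a, Suc n)) =
        Option.bind (\<Phi> p (prod_encode (a, n))) (\<lambda>v. g p (prod_encode (a, prod_encode (n, v))))"
    for p a n
    by (simp_all add: \<Phi>_def)
  have "simulates \<Psi> \<Phi>"
  proof (rule simulatesI)
    show "total_recursive \<Psi>"
      unfolding \<Psi>_def
      by (intro recursive_intros total_recursive_comp[OF simulatesD(1)[OF assms(1)]]
          total_recursive_comp[OF simulatesD(1)[OF assms(2)]])
  next
    fix t u c v k assume *: "\<Psi> t (prod_encode (c, prefix_code u k)) = Suc v"
    obtain a n where c: "c = prod_encode (a, n)"
      by (metis prod_decode_inverse surj_pair)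
    from * show "\<Phi> (join t u) c = Some v"
      unfolding c
    proof (induction n arbitrary: v)
      case 0
      then show ?case
        using simulatesD(2)[OF assms(1)] by (simp add: \<Psi>_simps \<Phi>_simps)
    next
      case (Suc n)
      then obtain y where y: "\<Psi> t (prod_encode (prod_encode (a, n), prefix_code u k)) = Suc y"
        by (cases "\<Psi> t (prod_encode (prod_encode (a, n), prefix_code u k))") (auto simp: \<Psi>_simps)
      with Suc.prems
      have "G t (prod_encode (prod_encode (a, prod_encode (n, y)), prefix_code u k)) = Suc v"
        by (simp add: \<Psi>_simps)
      from simulatesD(2)[OF assms(2) this] Suc.IH[OF y] show ?case
        by (simp add: \<Phi>_simps)
    qed
  next
    fix t u c v assume *: "\<Phi> (join t u) c = Some v"
    obtain a n where c: "c = prod_encode (a, n)"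
      by (metis prod_decode_inverse surj_pair)
    from * show "\<forall>\<^sub>F k in sequentially. \<Psi> t (prod_encode (c, prefix_code u k)) = Suc v"
      unfolding c
    proof (induction n arbitrary: v)
      case 0
      then show ?case
        using simulatesD(3)[OF assms(1)] by (simp add: \<Psi>_simps \<Phi>_simps)
    next
      case (Suc n)
      then obtain y where y: "\<Phi> (join t u) (prod_encode (a, n)) = Some y"
          "g (join t u) (prod_encode (a, prod_encode (n, y))) = Some v"
        by (auto simp: \<Phi>_simps bind_eq_Some_conv)
      from Suc.IH[OF y(1)] simulatesD(3)[OF assms(2) y(2)] show ?case
        by eventually_elim (simp add: \<Psi>_simps)
    qed
  qed
  then show ?thesis
    by (simp only: \<Psi>_def \<Phi>_def)
qed

text \<open>Bounded search, whose state is \<open>0\<close> while the search goes on, \<open>1\<close> once it has got stuck, and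
  \<open>m + 2\<close> once it has found \<open>m\<close>.\<close>

definition search :: "(nat \<Rightarrow> nat) \<Rightarrow> nat \<Rightarrow> nat" where
  "search y N = rec_nat 0
     (\<lambda>k r. if r = 0 then (if y k = 0 then 1 else if y k = 1 then k + 2 else 0) else r) N"

lemma search_simps [simp]:
  "search y 0 = 0"
  "search y (Suc N) = (if search y N = 0
     then (if y N = 0 then 1 else if y N = 1 then N + 2 else 0) else search y N)"
  by (simp_all add: search_def)

text \<open>\<open>y\<close> holds shifted values: \<open>0\<close> is unknown, \<open>1\<close> is
  a zero, and anything larger is a positive value.\<close>

lemma search_eq_0: "search y N = 0 \<longleftrightarrow> (\<forall>j<N. 2 \<le> y j)"
  by (induction N) (auto simp: less_Suc_eq)

lemma search_eq_found: "search y N = Suc (Suc m) \<longleftrightarrow> m < N \<and> y m = 1 \<and> (\<forall>j<m. 2 \<le> y j)"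
proof (induction N)
  case (Suc N)
  show ?case
  proof (cases "search y N = 0")
    case True
    then have "\<forall>j<N. 2 \<le> y j"
      by (simp add: search_eq_0)
    then have "m < Suc N \<and> y m = 1 \<and> (\<forall>j<m. 2 \<le> y j) \<longleftrightarrow> m = N \<and> y N = 1"
      by (auto simp: less_Suc_eq)
    with True show ?thesis
      by auto
  next
    case False
    then have "\<not> (\<forall>j<N. 2 \<le> y j)"
      by (simp add: search_eq_0)
    with False Suc show ?thesis
      by (auto simp: less_Suc_eq)
  qed
qed simp

text \<open>Subtracting \<open>1\<close> maps both the running and the stuck search to
  \<open>0\<close>, and a found \<open>m\<close> to \<open>Suc m\<close>. The prefix code itself
  bounds the search; it eventually exceeds every \<open>m\<close>.\<close>

lemma simulates_min:
  assumes "simulates F f"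
  shows "simulates (\<lambda>t c. search (\<lambda>m. F t (prod_encode (prod_encode (lproj c, m), rproj c))) (rproj c) - 1)
    (\<lambda>p a. minimize (\<lambda>n. f p (prod_encode (a, n))))"
    (is "simulates ?\<Psi> ?\<Phi>")
proof (rule simulatesI)
  show "total_recursive ?\<Psi>"
    unfolding search_def
    by (intro recursive_intros total_recursive_comp[OF simulatesD(1)[OF assms]])
next
  fix t u a m k assume "?\<Psi> t (prod_encode (a, prefix_code u k)) = Suc m"
  then have "search (\<lambda>m. F t (prod_encode (prod_encode (a, m), prefix_code u k))) (prefix_code u k) =
      Suc (Suc m)"
    by simp
  then have *: "F t (prod_encode (prod_encode (a, m), prefix_code u k)) = Suc 0"
      "\<And>j. j < m \<Longrightarrow> 2 \<le> F t (prod_encode (prod_encode (a, j), prefix_code u k))"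
    by (auto simp: search_eq_found)
  have "\<exists>v. f (join t u) (prod_encode (a, j)) = Some (Suc v)" if "j < m" for j
  proof -
    obtain v where "F t (prod_encode (prod_encode (a, j), prefix_code u k)) = Suc (Suc v)"
      using *(2)[OF \<open>j < m\<close>] by (metis add_2_eq_Suc le_Suc_ex)
    from simulatesD(2)[OF assms this] show ?thesis
      by blast
  qed
  with simulatesD(2)[OF assms *(1)] show "?\<Phi> (join t u) a = Some m"
    by (simp add: minimize_eq_Some)
next
  fix t u a m assume "?\<Phi> (join t u) a = Some m"
  then have *: "f (join t u) (prod_encode (a, m)) = Some 0"
      "\<forall>j<m. \<exists>v. f (join t u) (prod_encode (a, j)) = Some (Suc v)"
    by (auto simp: minimize_eq_Some)
  \<comment> \<open>Only finitely many values, those at \<open>j < m\<close>, must be known to be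
    positive, so one threshold serves them all.\<close>
  have "\<forall>\<^sub>F k in sequentially. \<forall>j\<in>{..<m}. 2 \<le> F t (prod_encode (prod_encode (a, j), prefix_code u k))"
  proof (intro eventually_ball_finite finite_lessThan ballI)
    fix j assume "j \<in> {..<m}"
    with *(2) obtain v where "f (join t u) (prod_encode (a, j)) = Some (Suc v)"
      by blast
    from simulatesD(3)[OF assms this]
    show "\<forall>\<^sub>F k in sequentially. 2 \<le> F t (prod_encode (prod_encode (a, j), prefix_code u k))"
      by eventually_elim simp
  qed
  with simulatesD(3)[OF assms *(1)] eventually_gt_at_top[of m]
  have "\<forall>\<^sub>F k in sequentially.
    search (\<lambda>m. F t (prod_encode (prod_encode (a, m), prefix_code u k))) (prefix_code u k) = Suc (Suc m)"
  proof eventually_elim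
    case (elim k)
    then show ?case
      using le_prefix_code[of k u] by (auto simp: search_eq_found)
  qed
  then show "\<forall>\<^sub>F k in sequentially. ?\<Psi> t (prod_encode (a, prefix_code u k)) = Suc m"
    by eventually_elim simp
qed

lemma partial_recursive_simulation:
  assumes "partial_recursive \<Phi>"
  shows "\<exists>\<Psi>. simulates \<Psi> \<Phi>"
  using assms
proof induction
  case pr_zero
  show ?case
    by (rule exI, rule simulates_total) (rule total_recursive_const)
next
  case pr_succ
  show ?case
    by (rule exI, rule simulates_total) (rule total_recursive_Suc_id)
next
  case pr_fst
  show ?case
    by (rule exI, rule simulates_total) (rule total_recursive_lproj_id)
next
  case pr_snd
  show ?case
    by (rule exI, rule simulates_total) (rule total_recursive_rproj_id)
next
  case pr_oracle
  show ?case
    by (rule exI, rule simulates_oracle)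
next
  case (pr_pair f g)
  then show ?case
    using simulates_pair by blast
next
  case (pr_comp f g)
  then show ?case
    using simulates_comp by blast
next
  case (pr_rec f g)
  then show ?case
    using simulates_rec by blast
next
  case (pr_min f)
  then show ?case
    using simulates_min by blast
qed

text \<open>
  A semidecision procedure with input \<open>join t u\<close> is turned into an associate, recursive in \<open>t\<close>, of a
  map into Sierpinski space with input \<open>u\<close>. Its \<open>\<langle>n, s\<rangle>\<close>-th output bit runs the simulation for
  argument \<open>n\<close> on a prefix of \<open>u\<close> with code at least \<open>\<langle>n, s\<rangle>\<close>, hence for arbitrarily many steps.
\<close>

lemma curry_semidecision:
  assumes "partial_recursive \<Phi>"
  obtains C where "recursive_pred C"
    and "\<And>t a u. \<exists>r. associate (\<lambda>i. C t (prod_encode (a, i))) u = Some r \<and>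
      ((\<exists>n. r n) \<longleftrightarrow> (\<exists>n. \<Phi> (join t u) (prod_encode (a, n)) = Some 1))"
proof -
  obtain \<Psi> where \<Psi>: "simulates \<Psi> \<Phi>"
    using partial_recursive_simulation[OF assms] by blast
  \<comment> \<open>Even positions hold the halting bits: for output bit \<open>n\<close>, a prefix
    suffices once its code is at least \<open>n\<close>. Odd positions hold the output;
    \<open>2\<close> is the shifted value \<open>1\<close>, that is, acceptance by
    \<open>\<Phi>\<close>.\<close>
  define C where "C = (\<lambda>t c.
    if even (rproj c) then lproj (rproj c div 2) \<le> rproj (rproj c div 2)
    else \<Psi> t (prod_encode (prod_encode (lproj c, lproj (lproj (rproj c div 2))), rproj (rproj c div 2))) = 2)"
  have "recursive_pred C"
    unfolding C_def by (intro recursive_intros total_recursive_comp[OF simulatesD(1)[OF \<Psi>]])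
  moreover have "\<exists>r. associate (\<lambda>i. C t (prod_encode (a, i))) u = Some r \<and>
      ((\<exists>n. r n) \<longleftrightarrow> (\<exists>n. \<Phi> (join t u) (prod_encode (a, n)) = Some 1))" for t a u
  proof -
    define K where "K n = (LEAST k. n \<le> prefix_code u k)" for n
    have K: "n \<le> prefix_code u (K n)" for n
      unfolding K_def by (rule LeastI[of _ n]) (rule le_prefix_code)
    define r where "r n \<longleftrightarrow>
      \<Psi> t (prod_encode (prod_encode (a, lproj n), prefix_code u (K n))) = 2" for n
    have "associate (\<lambda>i. C t (prod_encode (a, i))) u = Some r"
      using le_prefix_code unfolding associate_def Let_def C_def r_def K_def
      by (auto simp: fun_eq_iff)
    moreover have "(\<exists>n. r n) \<longleftrightarrow> (\<exists>n. \<Phi> (join t u) (prod_encode (a, n)) = Some 1)"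
    proof
      assume "\<exists>n. r n"
      then obtain n where
        "\<Psi> t (prod_encode (prod_encode (a, lproj n), prefix_code u (K n))) = Suc 1"
        by (auto simp: r_def numeral_2_eq_2)
      from simulatesD(2)[OF \<Psi> this] show "\<exists>n. \<Phi> (join t u) (prod_encode (a, n)) = Some 1"
        by blast
    next
      assume "\<exists>n. \<Phi> (join t u) (prod_encode (a, n)) = Some 1"
      then obtain n where "\<Phi> (join t u) (prod_encode (a, n)) = Some 1"
        by blast
      from simulatesD(3)[OF \<Psi> this] obtain N where
        N: "\<And>k. N \<le> k \<Longrightarrow> \<Psi> t (prod_encode (prod_encode (a, n), prefix_code u k)) = 2"
        by (auto simp: eventually_sequentially numeral_2_eq_2)
      \<comment> \<open>The second component is padding: it forces the output bit \<open>m\<close>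
        to be computed from a prefix of length at least \<open>N\<close>.\<close>
      define m where "m = prod_encode (n, 2 ^ Suc N)"
      have "2 ^ Suc N \<le> m"
        unfolding m_def by (rule le_prod_encode_2)
      also have "m \<le> prefix_code u (K m)"
        by (rule K)
      also have "\<dots> < 2 ^ Suc (K m)"
        using prefix_code_bounds by blast
      finally have "N \<le> K m"
        by (simp del: power_Suc)
      from N[OF this] have "r m"
        by (simp add: r_def m_def)
      then show "\<exists>n. r n" ..
    qed
    ultimately show ?thesis
      by blast
  qed
  ultimately show thesis
    by (rule that)
qed


section \<open>Membership in open sets\<close>

text \<open>The number \<open>\<langle>n, k\<rangle>\<close> witnesses that the associate \<open>q\<close>, having read \<open>k\<close> bits of \<open>r\<close>, outputs a
  true bit at position \<open>n\<close>.\<close>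

definition hit :: "cantor \<Rightarrow> cantor \<Rightarrow> nat \<Rightarrow> bool" where
  "hit q r c \<longleftrightarrow>
     q (2 * prod_encode (lproj c, prefix_code r (rproj c))) \<and>
     (\<forall>j<rproj c. \<not> q (2 * prod_encode (lproj c, prefix_code r j))) \<and>
     q (2 * prod_encode (lproj c, prefix_code r (rproj c)) + 1)"

text \<open>\<open>associate\<close> stops at the least sufficient prefix, which the first two
  conjuncts of \<open>hit\<close> pin down. As \<open>hit\<close> is decidable in \<open>q\<close>
  and \<open>r\<close>, membership in an open set becomes a search.\<close>

lemma hit_iff_associate:
  assumes "associate q r = Some b"
  shows "(\<exists>c. hit q r c) \<longleftrightarrow> (\<exists>n. b n)"
proof -
  have "b n \<longleftrightarrow> (\<exists>k. hit q r (prod_encode (n, k)))" for n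
  proof -
    let ?P = "\<lambda>k. q (2 * prod_encode (n, prefix_code r k))"
    have "?P k \<and> (\<forall>j<k. \<not> ?P j) \<longleftrightarrow> k = Least ?P" for k
      using LeastI_ex[OF associate_SomeD(1)[OF assms, of n]] not_less_Least[of _ ?P]
        Least_equality[of ?P k] by (metis linorder_not_le)
    then have "hit q r (prod_encode (n, k)) \<longleftrightarrow>
        k = Least ?P \<and> q (2 * prod_encode (n, prefix_code r k) + 1)" for k
      unfolding hit_def by (metis fst_conv prod_encode_inverse snd_conv)
    then show ?thesis
      by (simp add: associate_SomeD(2)[OF assms, of n])
  qed
  then show ?thesis
    by (metis prod_decode_inverse surj_pair)
qed

lemma recursive_pred_comp2:
  assumes "recursive_pred (\<lambda>p c. q p (lproj c) (rproj c))" "total_recursive f" "total_recursive g"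
  shows "recursive_pred (\<lambda>p c. q p (f p c) (g p c))"
  using recursive_pred_comp[OF assms(1) total_recursive_pair[OF assms(2,3)]] by simp

lemma recursive_pred_hit [recursive_intros]:
  assumes "recursive_pred (\<lambda>p c. q p (lproj c) (rproj c))"
    and "recursive_pred (\<lambda>p c. r p (lproj c) (rproj c))"
    and "total_recursive h"
  shows "recursive_pred (\<lambda>p n. hit (q p n) (r p n) (h p n))"
  unfolding hit_def
  by (intro recursive_intros recursive_pred_comp2[OF assms(1)] recursive_pred_comp2[OF assms(2)]
      total_recursive_comp[OF assms(3)] assms(3))

lemma open_rep_hit:
  assumes "open_rep X q = Some U" "X r = Some x"
  shows "x \<in> U \<longleftrightarrow> (\<exists>c. hit q r c)"
proof -
  have "realizes (associate q) X sierpinski (\<lambda>y. Some ((\<lambda>x\<in>ran X. x \<in> U) y))"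
    using assms(1) by (simp add: open_rep_eq_Some function_name_def)
  then have "\<exists>b. associate q r = Some b \<and> sierpinski b = Some ((\<lambda>x\<in>ran X. x \<in> U) x)"
    using assms(2) by (simp only: realizes_def)
  then obtain b where "associate q r = Some b" "(\<exists>n. b n) \<longleftrightarrow> x \<in> U"
    using assms(2) by (auto simp: sierpinski_def ranI)
  then show ?thesis
    using hit_iff_associate by blast
qed

lemma open_repI:
  assumes "U \<subseteq> ran X"
    and "\<And>r x. X r = Some x \<Longrightarrow> \<exists>b. associate q r = Some b \<and> ((\<exists>n. b n) \<longleftrightarrow> x \<in> U)"
  shows "open_rep X q = Some U"
proof -
  have "\<exists>b. associate q r = Some b \<and> sierpinski b = Some ((\<lambda>x\<in>ran X. x \<in> U) x)" if "X r = Some x" for r x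
    using assms(2)[OF that] that by (auto simp: sierpinski_def ranI)
  with assms(1) show ?thesis
    by (simp add: open_rep_eq_Some function_name_def realizes_def)
qed

lemma computable_recursive_pred:
  assumes "recursive_pred P"
  shows "computable (\<lambda>t. Some (P t))"
  using assms unfolding recursive_pred_def total_recursive_def computable_def by auto

text \<open>The realizer of \<open>S\<close> is run on recursive names of all pairs. That
  \<open>s\<close> ignores the oracle \<open>t\<close> expresses that it is recursive
  outright.\<close>

lemma computable_subbase_names:
  assumes "computable_map (prod_rep nat_rep bit_rep) (open_rep X) (\<lambda>(n, i). Some (S n i))"
  obtains s where "recursive_pred (\<lambda>t. s)"
    and "\<And>k a. open_rep X (\<lambda>i. s (prod_encode (prod_encode (k, of_bool a), i))) = Some (S k a)"
proof -
  obtain F \<Phi> where F: "realizes F (prod_rep nat_rep bit_rep) (open_rep X) (\<lambda>(n, i). Some (S n i))"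
    and \<Phi>: "partial_recursive \<Phi>" "\<And>p q n. F p = Some q \<Longrightarrow> \<Phi> p n = Some (of_bool (q n))"
    using assms by (auto simp: computable_map_def computable_def)
  \<comment> \<open>The even bits name the number \<open>lproj c\<close> by a single one, and the
    odd bits repeat the truth value.\<close>
  define z where "z c m \<longleftrightarrow> (if even m then m div 2 = lproj c else rproj c = 1)" for c m :: nat
  have z: "prod_rep nat_rep bit_rep (z c) = Some (lproj c, rproj c = 1)" for c
    by (auto simp: prod_rep_def nat_rep_def bit_rep_def z_def intro!: Least_equality)
  have "\<exists>q. F (z c) = Some q \<and> open_rep X q = Some (S (lproj c) (rproj c = 1))" for c
    using F z[of c] unfolding realizes_def by fastforce
  then obtain q where q: "F (z c) = Some (q c)"
      "open_rep X (q c) = Some (S (lproj c) (rproj c = 1))" for c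
    by metis
  have "recursive_pred (\<lambda>t c. z (lproj c) (rproj c))"
    unfolding z_def by (intro recursive_intros)
  then have "recursive_pred (\<lambda>t c. q (lproj c) (rproj c))"
    by (rule recursive_pred_oracle_subst[OF \<Phi>(1)]) (simp add: \<Phi>(2)[OF q(1)])
  moreover have "open_rep X (\<lambda>i. q (lproj (prod_encode (prod_encode (k, of_bool a), i)))
      (rproj (prod_encode (prod_encode (k, of_bool a), i)))) = Some (S k a)" for k a
    using q(2)[of "prod_encode (k, of_bool a)"] by simp
  ultimately show thesis
    by (rule that)
qed


section \<open>Cells of the subbase\<close>

text \<open>Two finite sets list the positions with value 0 and with value 1. Where they overlap,
  \<open>False\<close> wins, so every number is a code.\<close>

definition cell_code :: "nat \<Rightarrow> nat \<Rightarrow> plotkin" where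
  "cell_code m k = (if k \<in> set_decode (lproj m) then Some False
     else if k \<in> set_decode (rproj m) then Some True else None)"

lemma set_decode_bound:
  assumes "k \<in> set_decode n"
  shows "k < n"
proof -
  have "2 ^ k \<le> n"
    using assms by (intro leI) (auto simp: set_decode_def)
  then show ?thesis
    using less_exp[of k] by linarith
qed

text \<open>Makes quantifiers over the positions of a cell bounded, so that they preserve
  decidability.\<close>

lemma cell_code_bound:
  assumes "cell_code m k = Some a"
  shows "k < m"
proof -
  have "lproj m \<le> m" "rproj m \<le> m"
    using le_prod_encode_1[of "lproj m" "rproj m"] le_prod_encode_2[of "rproj m" "lproj m"] by simp_all
  then show ?thesis
    using assms set_decode_bound[of k "lproj m"] set_decode_bound[of k "rproj m"]
    by (auto simp: cell_code_def split: if_splits)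
qed

text \<open>Transfers properness, which speaks of lists, to coded cells.\<close>

lemma cell_code_eq_finite_seq: "cell_code m = finite_seq (map (cell_code m) [0..<m])"
proof
  show "cell_code m k = finite_seq (map (cell_code m) [0..<m]) k" for k
    using cell_code_bound[of m k] by (cases "cell_code m k") (auto simp: finite_seq_def)
qed

lemma finite_seq_eq_cell_code: "\<exists>m. finite_seq e = cell_code m"
proof
  let ?A = "\<lambda>a. {k. k < length e \<and> e ! k = Some a}"
  show "finite_seq e = cell_code (prod_encode (set_encode (?A False), set_encode (?A True)))"
  proof
    show "finite_seq e k = cell_code (prod_encode (set_encode (?A False), set_encode (?A True))) k" for k
      by (cases "e ! k") (auto simp: finite_seq_def cell_code_def)
  qed
qed

lemma recursive_pred_cell_code [recursive_intros]:
  assumes "total_recursive f" "total_recursive g"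
  shows "recursive_pred (\<lambda>p n. cell_code (f p n) (g p n) = Some a)"
proof -
  have "cell_code m k = Some a \<longleftrightarrow>
      (if odd (lproj m div 2 ^ k) then \<not> a else odd (rproj m div 2 ^ k) \<and> a)" for m k
    by (auto simp: cell_code_def set_decode_def)
  then show ?thesis
    by (simp only:) (intro recursive_intros assms)
qed

text \<open>For a proper subbase, this is the exterior of the cell.\<close>

definition cell_exterior :: "(nat \<Rightarrow> bool \<Rightarrow> 'a set) \<Rightarrow> nat \<Rightarrow> 'a set" where
  "cell_exterior S m = {x. \<exists>k a. cell_code m k = Some a \<and> x \<in> S k (\<not> a)}"

lemma dyadic_subbase_disjoint:
  assumes "dyadic_subbase X S" "x \<in> S n a" "x \<in> S n b"
  shows "a = b"
  using assms by (cases a; cases b) (auto simp: dyadic_subbase_def)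

lemma cell_exterior_disjoint:
  assumes "dyadic_subbase X S" "x \<in> cell_exterior S m"
  shows "x \<notin> subbase_cell X S (cell_code m)"
  using assms(2) dyadic_subbase_disjoint[OF assms(1)]
  by (fastforce simp: cell_exterior_def subbase_cell_def)

lemma subbase_subset:
  assumes "dyadic_subbase X S"
  shows "S k a \<subseteq> ran X"
proof -
  have "openin (rtop X) (S k a)"
    using assms unfolding dyadic_subbase_def ran_open_rep by blast
  from openin_subset[OF this] show ?thesis
    by simp
qed

text \<open>Induction on the generation of the topology. For an intersection the two sequences are
  merged; where both are defined they agree, as \<open>x\<close> lies in both cells and opposite
  subbasic sets are disjoint.\<close>

lemma subbase_cells_form_base:
  assumes S: "dyadic_subbase X S" and "openin (rtop X) U" "x \<in> U"
  obtains m where "x \<in> subbase_cell X S (cell_code m)" "subbase_cell X S (cell_code m) \<subseteq> U"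
proof -
  have "rtop X = topology_generated_by (insert (ran X) {S n i | n i. True})"
    using S unfolding dyadic_subbase_def by blast
  with assms(2) have "generate_topology_on (insert (ran X) {S n i | n i. True}) U"
    using openin_topology_generated_by by metis
  then have "\<exists>e. x \<in> subbase_cell X S (finite_seq e) \<and> subbase_cell X S (finite_seq e) \<subseteq> U"
    using assms(3)
  proof (induction U)
    case (Int U V)
    then obtain e f where e: "x \<in> subbase_cell X S (finite_seq e)" "subbase_cell X S (finite_seq e) \<subseteq> U"
      and f: "x \<in> subbase_cell X S (finite_seq f)" "subbase_cell X S (finite_seq f) \<subseteq> V"
      by blast
    define g where "g = map (\<lambda>k. if finite_seq e k = None then finite_seq f k else finite_seq e k)
      [0..<max (length e) (length f)]"
    have g: "finite_seq g k = (if finite_seq e k = None then finite_seq f k else finite_seq e k)" for k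
      by (auto simp: g_def finite_seq_def)
    have "finite_seq g k = Some a" if "finite_seq f k = Some a" for k a
    proof (cases "finite_seq e k")
      case (Some b)
      then have "x \<in> S k a" "x \<in> S k b"
        using that e(1) f(1) by (auto simp: subbase_cell_def)
      with dyadic_subbase_disjoint[OF S] Some show ?thesis
        by (auto simp: g)
    qed (simp add: g that)
    moreover have "finite_seq g k = Some a" if "finite_seq e k = Some a" for k a
      by (simp add: g that)
    ultimately have "subbase_cell X S (finite_seq g) \<subseteq> U \<inter> V"
      using e(2) f(2) unfolding subbase_cell_def by blast
    moreover have "x \<in> subbase_cell X S (finite_seq g)"
      using e(1) f(1) by (auto simp: subbase_cell_def g split: if_splits)
    ultimately show ?case
      by blast
  next
    case (UN K)
    then show ?case
      by blast
  next
    case (Basis V)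
    then consider "V = ran X" | n i where "V = S n i"
      by blast
    then show ?case
    proof cases
      case 1
      with Basis show ?thesis
        by (intro exI[of _ "[]"]) (auto simp: subbase_cell_def finite_seq_def)
    next
      case 2
      have "finite_seq (replicate n None @ [Some i]) k = (if k = n then Some i else None)" for k
        by (auto simp: finite_seq_def nth_append)
      with 2 Basis(2) subbase_subset[OF S] show ?thesis
        by (intro exI[of _ "replicate n None @ [Some i]"]) (auto simp: subbase_cell_def)
    qed
  qed simp
  then show thesis
    using that finite_seq_eq_cell_code by metis
qed

text \<open>A point outside \<open>A\<close> is separated from \<open>A\<close> by open sets
  \<open>U\<close> and \<open>V\<close>. A cell around the point within \<open>U\<close> has a
  closure disjoint from \<open>V\<close>; by properness this closure is the closed cell, so
  \<open>A\<close> lies in the exterior and the cell is excluded.\<close>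

lemma compact_eq_excluded_cells:
  assumes S: "dyadic_subbase X S" and proper: "proper_subbase X S"
    and X: "Hausdorff_space (rtop X)" and A: "compactin (rtop X) A"
  shows "A = {x \<in> ran X. \<forall>m. A \<subseteq> cell_exterior S m \<longrightarrow> x \<notin> subbase_cell X S (cell_code m)}"
proof (intro equalityI subsetI)
  fix x assume "x \<in> A"
  moreover have "A \<subseteq> ran X"
    using compactin_subset_topspace[OF A] by simp
  ultimately show "x \<in> {x \<in> ran X. \<forall>m. A \<subseteq> cell_exterior S m \<longrightarrow> x \<notin> subbase_cell X S (cell_code m)}"
    using cell_exterior_disjoint[OF S] by blast
next
  fix x
  assume x: "x \<in> {x \<in> ran X. \<forall>m. A \<subseteq> cell_exterior S m \<longrightarrow> x \<notin> subbase_cell X S (cell_code m)}"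
  show "x \<in> A"
  proof (rule ccontr)
    assume "x \<notin> A"
    moreover have "compactin (rtop X) {x}"
      using x by simp
    ultimately obtain U V where UV: "openin (rtop X) U" "openin (rtop X) V" "{x} \<subseteq> U" "A \<subseteq> V" "disjnt U V"
      using Hausdorff_space_compact_separation[OF X _ A, of "{x}"] by (metis disjnt_insert1 disjnt_empty1)
    obtain m where m: "x \<in> subbase_cell X S (cell_code m)" "subbase_cell X S (cell_code m) \<subseteq> U"
      using subbase_cells_form_base[OF S UV(1)] UV(3) by auto
    have "rtop X closure_of subbase_cell X S (cell_code m) = subbase_closed_cell X S (cell_code m)"
      using proper cell_code_eq_finite_seq[of m] unfolding proper_subbase_def by metis
    moreover have "y \<notin> rtop X closure_of subbase_cell X S (cell_code m)" if "y \<in> V" for y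
      using that UV(2,5) m(2) unfolding in_closure_of disjnt_iff by blast
    moreover have "V \<subseteq> ran X"
      using openin_subset[OF UV(2)] by simp
    ultimately have "A \<subseteq> cell_exterior S m"
      using UV(4) unfolding subbase_closed_cell_def cell_exterior_def by blast
    with x m(1) show False
      by blast
  qed
qed


section \<open>The matching representations\<close>

definition point_rep :: "'a rspace \<Rightarrow> (nat \<Rightarrow> bool \<Rightarrow> 'a set) \<Rightarrow> 'a rspace" where
  "point_rep X S q = Option.bind (X (\<lambda>n. q (2 * n))) (\<lambda>x.
     if \<forall>m. x \<in> subbase_cell X S (cell_code m) \<longrightarrow> q (2 * m + 1) then Some x else None)"

definition excluded_cells_set ::
  "'a rspace \<Rightarrow> (nat \<Rightarrow> bool \<Rightarrow> 'a set) \<Rightarrow> (nat \<Rightarrow> plotkin) \<Rightarrow> 'a set" where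
  "excluded_cells_set X S p =
     {x \<in> ran X. \<forall>m. p (2 * m + 1) = Some False \<longrightarrow> x \<notin> subbase_cell X S (cell_code m)}"

text \<open>Undefined even positions leave the \<open>X\<close>-name inside a
  \<open>point_rep\<close> name unconstrained.\<close>

definition set_rep :: "'a rspace \<Rightarrow> (nat \<Rightarrow> bool \<Rightarrow> 'a set) \<Rightarrow> (nat \<Rightarrow> plotkin) \<rightharpoonup> 'a set" where
  "set_rep X S p =
     (if (\<forall>n. p (2 * n) = None) \<and> compactin (rtop X) (excluded_cells_set X S p)
      then Some (excluded_cells_set X S p) else None)"

lemma point_rep_eq_Some:
  "point_rep X S q = Some x \<longleftrightarrow> X (\<lambda>n. q (2 * n)) = Some x \<and>
     (\<forall>m. x \<in> subbase_cell X S (cell_code m) \<longrightarrow> q (2 * m + 1))"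
  by (auto simp: point_rep_def bind_eq_Some_conv)

lemma set_rep_eq_Some:
  "set_rep X S p = Some A \<longleftrightarrow> (\<forall>n. p (2 * n) = None) \<and> A = excluded_cells_set X S p \<and>
     compactin (rtop X) A"
  by (auto simp: set_rep_def)

text \<open>One direction drops the odd bits; the other sets them all to true, which is admissible
  for every point.\<close>

lemma rep_equiv_point_rep: "rep_equiv (point_rep X S) X"
proof -
  have "computable_map (point_rep X S) X Some"
    unfolding computable_map_def
  proof (intro exI conjI)
    show "computable (\<lambda>q. Some (\<lambda>n. q (2 * n)))"
      by (intro computable_recursive_pred recursive_intros)
    show "realizes (\<lambda>q. Some (\<lambda>n. q (2 * n))) (point_rep X S) X Some"
      by (auto simp: realizes_def point_rep_eq_Some)
  qed
  moreover have "computable_map X (point_rep X S) Some"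
    unfolding computable_map_def
  proof (intro exI conjI)
    show "computable (\<lambda>r. Some (\<lambda>n. if even n then r (n div 2) else True))"
      by (intro computable_recursive_pred recursive_intros)
    show "realizes (\<lambda>r. Some (\<lambda>n. if even n then r (n div 2) else True)) X (point_rep X S) Some"
      by (auto simp: realizes_def point_rep_eq_Some)
  qed
  ultimately show ?thesis
    by (simp add: rep_equiv_def)
qed

text \<open>The equivalence holds for each single name \<open>p\<close>, so both forms of matching
  follow once \<open>A\<close> has a name.\<close>

lemma set_rep_matches_point_rep:
  assumes A: "set_rep X S p = Some A" and "x \<in> ran X"
  shows "x \<in> A \<longleftrightarrow> (\<exists>q. p \<preceq>\<^sub>T total_seq q \<and> point_rep X S q = Some x)"
proof
  assume x: "x \<in> A"
  obtain r where r: "X r = Some x"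
    using assms(2) by (auto simp: ran_def)
  \<comment> \<open>An odd bit is false only where \<open>p\<close> demands it; there the cell
    misses \<open>x\<close> because \<open>x\<close> lies in \<open>A\<close>.\<close>
  let ?q = "join r (\<lambda>m. p (2 * m + 1) \<noteq> Some False)"
  have "p \<preceq>\<^sub>T total_seq ?q"
    unfolding refines_def
  proof (intro allI impI)
    fix n assume n: "p n \<noteq> None"
    then have "odd n"
      using A by (auto simp: set_rep_eq_Some elim!: evenE)
    then obtain m where "n = 2 * m + 1"
      by (rule oddE)
    with n show "p n = total_seq ?q n"
      by (auto simp: total_seq_def)
  qed
  moreover have "point_rep X S ?q = Some x"
    using x A r by (auto simp: point_rep_eq_Some set_rep_eq_Some excluded_cells_set_def)
  ultimately show "\<exists>q. p \<preceq>\<^sub>T total_seq q \<and> point_rep X S q = Some x"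
    by blast
next
  assume "\<exists>q. p \<preceq>\<^sub>T total_seq q \<and> point_rep X S q = Some x"
  then obtain q where q: "p \<preceq>\<^sub>T total_seq q" "point_rep X S q = Some x"
    by blast
  have "\<not> q (2 * m + 1)" if "p (2 * m + 1) = Some False" for m
  proof -
    have "p (2 * m + 1) = total_seq q (2 * m + 1)"
      using q(1) that unfolding refines_def by (metis option.distinct(1))
    with that show ?thesis
      by (simp add: total_seq_def)
  qed
  with q(2) assms(2) A show "x \<in> A"
    by (auto simp: set_rep_eq_Some excluded_cells_set_def point_rep_eq_Some)
qed

text \<open>Excluding every cell whose exterior covers \<open>A\<close> removes no point of
  \<open>A\<close> and, by \<open>compact_eq_excluded_cells\<close>, all others. Such a
  \<open>p\<close> serves both surjectivity and the computation from compact names.\<close>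

lemma set_rep_canonical:
  assumes "dyadic_subbase X S" "proper_subbase X S" "Hausdorff_space (rtop X)" "compactin (rtop X) A"
    and "\<And>n. p (2 * n) = None"
    and "\<And>m. p (2 * m + 1) = Some False \<longleftrightarrow> A \<subseteq> cell_exterior S m"
  shows "set_rep X S p = Some A"
  using compact_eq_excluded_cells[OF assms(1-4)] assms(4-6)
  by (simp add: set_rep_eq_Some excluded_cells_set_def)

lemma ran_set_rep:
  assumes "dyadic_subbase X S" "proper_subbase X S" "Hausdorff_space (rtop X)"
  shows "ran (set_rep X S) = {A. compactin (rtop X) A}"
proof (intro equalityI subsetI)
  fix A assume "A \<in> ran (set_rep X S)"
  then show "A \<in> {A. compactin (rtop X) A}"
    by (auto simp: ran_def set_rep_eq_Some)
next
  fix A assume "A \<in> {A. compactin (rtop X) A}"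
  then have "set_rep X S (\<lambda>n. if odd n \<and> A \<subseteq> cell_exterior S (n div 2) then Some False else None) = Some A"
    by (intro set_rep_canonical[OF assms]) auto
  then show "A \<in> ran (set_rep X S)"
    by (rule ranI[of "set_rep X S"])
qed

lemma plotkin_seq_rep_eq_Some:
  "plotkin_seq_rep t = Some p \<longleftrightarrow> (\<forall>n. p n =
     (if \<exists>m. t (prod_encode (n, m)) then Some (odd (LEAST m. t (prod_encode (n, m)))) else None))"
  by (auto simp: plotkin_seq_rep_def seq_rep_def plotkin_rep_def dom_def fun_eq_iff)

text \<open>Trades the \<open>LEAST\<close> for a witness \<open>l\<close> that is checked on
  finitely many bits of \<open>t\<close>.\<close>

lemma plotkin_seq_rep_False:
  assumes "plotkin_seq_rep t = Some p"
  shows "p n = Some False \<longleftrightarrow>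
    (\<exists>l. t (prod_encode (n, l)) \<and> even l \<and> (\<forall>j<l. \<not> t (prod_encode (n, j))))"
proof -
  let ?P = "\<lambda>m. t (prod_encode (n, m))"
  have "(\<exists>m. ?P m) \<and> even (Least ?P) \<longleftrightarrow> (\<exists>l. ?P l \<and> even l \<and> (\<forall>j<l. \<not> ?P j))"
  proof
    assume "(\<exists>m. ?P m) \<and> even (Least ?P)"
    then show "\<exists>l. ?P l \<and> even l \<and> (\<forall>j<l. \<not> ?P j)"
      using LeastI_ex[of ?P] not_less_Least[of _ ?P] by blast
  next
    assume "\<exists>l. ?P l \<and> even l \<and> (\<forall>j<l. \<not> ?P j)"
    then obtain l where l: "?P l" "even l" "\<forall>j<l. \<not> ?P j"
      by blast
    then have "Least ?P = l"
      by (intro Least_equality) (auto simp: not_less[symmetric])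
    with l show "(\<exists>m. ?P m) \<and> even (Least ?P)"
      by auto
  qed
  moreover have "p n = (if \<exists>m. ?P m then Some (odd (Least ?P)) else None)"
    using assms by (simp add: plotkin_seq_rep_eq_Some)
  ultimately show ?thesis
    by auto
qed

text \<open>Saturation is automatic: for \<open>y\<close> outside \<open>A\<close>, the complement
  of the closed set \<open>{y}\<close> is an open superset of \<open>A\<close>.\<close>

lemma compact_nameI:
  assumes X: "Hausdorff_space (rtop X)" and A: "compactin (rtop X) A"
    and "open_rep (open_rep X) q = Some {U \<in> ran (open_rep X). A \<subseteq> U}"
  shows "compact_name X q A"
proof -
  have "A \<subseteq> ran X"
    using compactin_subset_topspace[OF A] by simp
  have "y \<in> A" if y: "y \<in> \<Inter>{U. openin (rtop X) U \<and> A \<subseteq> U}" for y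
  proof (rule ccontr)
    assume "y \<notin> A"
    have "openin (rtop X) (topspace (rtop X) - {y})"
      using Hausdorff_imp_t1_space[OF X] openin_topspace unfolding t1_space_openin_delete_alt by blast
    with y \<open>y \<notin> A\<close> \<open>A \<subseteq> ran X\<close> show False
      by auto
  qed
  then have "A = \<Inter>{U. openin (rtop X) U \<and> A \<subseteq> U}"
    by blast
  with assms show ?thesis
    by (simp add: compact_name_def)
qed

section \<open>Translating between \<open>set_rep\<close> names and compact names\<close>

locale named_subbase =
  fixes X :: "'a rspace" and S :: "nat \<Rightarrow> bool \<Rightarrow> 'a set" and s :: cantor
  assumes subbase: "dyadic_subbase X S"
    and names: "\<And>k a. open_rep X (\<lambda>i. s (prod_encode (prod_encode (k, of_bool a), i))) = Some (S k a)"
    and recursive_names: "recursive_pred (\<lambda>t. s)"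
begin

definition sname :: "nat \<Rightarrow> bool \<Rightarrow> cantor" where
  "sname k a = (\<lambda>i. s (prod_encode (prod_encode (k, of_bool a), i)))"

text \<open>A cell is a finite intersection, so a single \<open>N\<close> bounds the hits for all
  its positions.\<close>

definition cell_witness :: "nat \<Rightarrow> cantor \<Rightarrow> nat \<Rightarrow> bool" where
  "cell_witness m r N \<longleftrightarrow>
     (\<forall>k<m. (cell_code m k = Some True \<longrightarrow> (\<exists>c<N. hit (sname k True) r c)) \<and>
            (cell_code m k = Some False \<longrightarrow> (\<exists>c<N. hit (sname k False) r c)))"

text \<open>The exterior is a union, so one hit is enough.\<close>

definition exterior_witness :: "nat \<Rightarrow> cantor \<Rightarrow> nat \<Rightarrow> bool" where
  "exterior_witness m r c \<longleftrightarrow>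
     (\<exists>k<m. (cell_code m k = Some True \<and> hit (sname k False) r c) \<or>
            (cell_code m k = Some False \<and> hit (sname k True) r c))"

lemma recursive_pred_sname [recursive_intros]:
  assumes "total_recursive f" "total_recursive g"
  shows "recursive_pred (\<lambda>p n. sname (f p n) a (g p n))"
  unfolding sname_def by (intro recursive_pred_comp[OF recursive_names] recursive_intros assms)

lemma recursive_pred_cell_witness [recursive_intros]:
  assumes "total_recursive f" "recursive_pred (\<lambda>p c. r p (lproj c) (rproj c))" "total_recursive h"
  shows "recursive_pred (\<lambda>p n. cell_witness (f p n) (r p n) (h p n))"
  unfolding cell_witness_def
  by (intro recursive_intros total_recursive_comp[OF assms(1)] total_recursive_comp[OF assms(3)]
      recursive_pred_comp2[OF assms(2)] assms)

lemma recursive_pred_exterior_witness [recursive_intros]: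
  assumes "total_recursive f" "recursive_pred (\<lambda>p c. r p (lproj c) (rproj c))" "total_recursive h"
  shows "recursive_pred (\<lambda>p n. exterior_witness (f p n) (r p n) (h p n))"
  unfolding exterior_witness_def
  by (intro recursive_intros total_recursive_comp[OF assms(1)] total_recursive_comp[OF assms(3)]
      recursive_pred_comp2[OF assms(2)] assms)

lemma subbase_hit:
  assumes "X r = Some x"
  shows "x \<in> S k a \<longleftrightarrow> (\<exists>c. hit (sname k a) r c)"
  using open_rep_hit[OF names assms] unfolding sname_def .

lemma cell_witness:
  assumes "X r = Some x"
  shows "x \<in> subbase_cell X S (cell_code m) \<longleftrightarrow> (\<exists>N. cell_witness m r N)"
proof
  assume "\<exists>N. cell_witness m r N"
  then obtain N where N: "cell_witness m r N"
    by blast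
  have "x \<in> S k a" if "cell_code m k = Some a" for k a
  proof -
    have "\<exists>c<N. hit (sname k a) r c"
      using N that cell_code_bound[OF that] by (cases a) (auto simp: cell_witness_def)
    then show ?thesis
      using subbase_hit[OF assms] by blast
  qed
  then show "x \<in> subbase_cell X S (cell_code m)"
    using assms by (auto simp: subbase_cell_def ranI)
next
  assume x: "x \<in> subbase_cell X S (cell_code m)"
  have "\<exists>c. \<forall>a. cell_code m k = Some a \<longrightarrow> hit (sname k a) r c" for k
  proof (cases "cell_code m k")
    case (Some a)
    then have "x \<in> S k a"
      using x by (simp add: subbase_cell_def)
    with Some show ?thesis
      using subbase_hit[OF assms] by simp
  qed simp
  then obtain c where c: "\<And>k a. cell_code m k = Some a \<Longrightarrow> hit (sname k a) r (c k)"
    by metis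
  obtain N where N: "\<And>k. k < m \<Longrightarrow> c k < N"
    using finite_nat_set_iff_bounded[of "c ` {..<m}"] by auto
  have "cell_witness m r N"
    unfolding cell_witness_def using c[of _ True] c[of _ False] N by blast
  then show "\<exists>N. cell_witness m r N" ..
qed

lemma exterior_witness:
  assumes "X r = Some x"
  shows "x \<in> cell_exterior S m \<longleftrightarrow> (\<exists>c. exterior_witness m r c)"
proof -
  have "x \<in> cell_exterior S m \<longleftrightarrow> (\<exists>k a. cell_code m k = Some a \<and> (\<exists>c. hit (sname k (\<not> a)) r c))"
    by (simp add: cell_exterior_def subbase_hit[OF assms])
  also have "\<dots> \<longleftrightarrow> (\<exists>c. \<exists>k<m. \<exists>a. cell_code m k = Some a \<and> hit (sname k (\<not> a)) r c)"
    using cell_code_bound by blast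
  finally show ?thesis
    by (simp only: exterior_witness_def ex_bool_eq not_True_eq_False not_False_eq_True)
qed

text \<open>Two nested curryings: \<open>C\<close> computes a name of the union \<open>V\<close> of
  \<open>U\<close> and the excluded cells, and \<open>B\<close> makes the emptiness test on the
  complement of \<open>V\<close> a function of the name \<open>u\<close> of
  \<open>U\<close>.\<close>

lemma computable_set_rep_to_compact_rep:
  assumes compact: "computably_compact X" and Hausdorff: "Hausdorff_space (rtop X)"
  shows "computable_map (set_rep X S \<circ>\<^sub>m plotkin_seq_rep) (compact_rep X) Some"
proof -
  obtain E \<Phi> where E: "realizes E (closed_rep X) sierpinski (\<lambda>A. Some (A = {}))"
    and \<Phi>: "partial_recursive \<Phi>" "\<And>p q n. E p = Some q \<Longrightarrow> \<Phi> p n = Some (of_bool (q n))"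
    using compact by (auto simp: computably_compact_def computable_map_def computable_def)
  \<comment> \<open>\<open>w\<close> is either a hit showing membership in \<open>U\<close>, or
    codes <m, <l, N>>: \<open>l\<close> is evidence in \<open>t\<close> that cell \<open>m\<close>
    is excluded, and \<open>N\<close> that the point lies in it.\<close>
  define D where "D t u r w \<longleftrightarrow> hit u r w \<or>
    (t (prod_encode (2 * lproj w + 1, lproj (rproj w))) \<and> even (lproj (rproj w)) \<and>
     (\<forall>j<lproj (rproj w). \<not> t (prod_encode (2 * lproj w + 1, j))) \<and>
     cell_witness (lproj w) r (rproj (rproj w)))" for t u r :: cantor and w
  define G where "G = (\<lambda>z c. Some (of_bool (D (\<lambda>i. z (2 * (2 * i))) (\<lambda>i. z (2 * (2 * i + 1)))
    (\<lambda>i. z (2 * i + 1)) (rproj c)) :: nat))"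
  have "partial_recursive G"
    unfolding G_def D_def total_recursive_def[symmetric] by (intro recursive_intros)
  then obtain C where C: "recursive_pred C"
    "\<And>y a r. \<exists>b. associate (\<lambda>i. C y (prod_encode (a, i))) r = Some b \<and>
      ((\<exists>n. b n) \<longleftrightarrow> (\<exists>n. G (join y r) (prod_encode (a, n)) = Some 1))"
    by (rule curry_semidecision) blast
  have G: "G (join (join t u) r) (prod_encode (a, w)) = Some 1 \<longleftrightarrow> D t u r w" for t u r a w
    by (simp only: G_def join_simps prod_encode_inverse snd_conv option.inject of_bool_eq_1_iff)
  have V: "\<exists>b. associate (\<lambda>i. C (join t u) (prod_encode (0, i))) r = Some b \<and>
      ((\<exists>n. b n) \<longleftrightarrow> (\<exists>w. D t u r w))" for t u r
    using C(2)[of "join t u" 0 r] unfolding G .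
  \<comment> \<open>The emptiness test takes as its oracle the name of \<open>V\<close> computed
    from \<open>join t u\<close>; only one set is named, so the index is fixed at
    \<open>0\<close>.\<close>
  have "recursive_pred (\<lambda>y c. C y (prod_encode (0, rproj c)))"
    by (intro recursive_pred_comp[OF C(1)] recursive_intros)
  from partial_recursive_oracle_subst[OF \<Phi>(1) this]
  have "partial_recursive (\<lambda>y c. \<Phi> (\<lambda>i. C y (prod_encode (0, i))) (rproj c))"
    by simp
  then obtain B where B: "recursive_pred B"
    "\<And>t a u. \<exists>b. associate (\<lambda>i. B t (prod_encode (a, i))) u = Some b \<and>
      ((\<exists>n. b n) \<longleftrightarrow>
        (\<exists>n. \<Phi> (\<lambda>i. C (join t u) (prod_encode (0, i))) (rproj (prod_encode (a, n))) = Some 1))"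
    by (rule curry_semidecision) blast
  show ?thesis
    unfolding computable_map_def
  proof (intro exI conjI)
    show "computable (\<lambda>t. Some (\<lambda>i. B t (prod_encode (0, i))))"
      by (intro computable_recursive_pred recursive_pred_comp[OF B(1)] recursive_intros)
    show "realizes (\<lambda>t. Some (\<lambda>i. B t (prod_encode (0, i)))) (set_rep X S \<circ>\<^sub>m plotkin_seq_rep)
        (compact_rep X) Some"
      unfolding realizes_def
    proof (intro allI impI)
      fix t A A' assume "(set_rep X S \<circ>\<^sub>m plotkin_seq_rep) t = Some A" and "Some A = Some A'"
      then obtain p where p: "plotkin_seq_rep t = Some p" "set_rep X S p = Some A" and "A' = A"
        unfolding map_comp_Some_iff by blast
      define Q where "Q = (\<lambda>i. B t (prod_encode (0, i)))"
      have A: "compactin (rtop X) A"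
          "A = {x \<in> ran X. \<forall>m. p (2 * m + 1) = Some False \<longrightarrow> x \<notin> subbase_cell X S (cell_code m)}"
        using p(2) unfolding set_rep_eq_Some excluded_cells_set_def by blast+
      have "open_rep (open_rep X) Q = Some {U \<in> ran (open_rep X). A \<subseteq> U}"
      proof (rule open_repI)
        fix u U assume u: "open_rep X u = Some U"
        define V where "V = {x \<in> ran X. x \<in> U \<or>
          (\<exists>m. p (2 * m + 1) = Some False \<and> x \<in> subbase_cell X S (cell_code m))}"
        define v where "v = (\<lambda>i. C (join t u) (prod_encode (0, i)))"
        have "open_rep X v = Some V"
        proof (rule open_repI)
          fix r x assume r: "X r = Some x"
          have "(\<exists>w. D t u r w) \<longleftrightarrow> (\<exists>c. hit u r c) \<or> (\<exists>m l N.
              (t (prod_encode (2 * m + 1, l)) \<and> even l \<and>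
               (\<forall>j<l. \<not> t (prod_encode (2 * m + 1, j)))) \<and> cell_witness m r N)"
          proof
            assume "(\<exists>c. hit u r c) \<or> (\<exists>m l N. (t (prod_encode (2 * m + 1, l)) \<and> even l \<and>
               (\<forall>j<l. \<not> t (prod_encode (2 * m + 1, j)))) \<and> cell_witness m r N)"
            then show "\<exists>w. D t u r w"
            proof (elim disjE exE)
              fix m l N assume "(t (prod_encode (2 * m + 1, l)) \<and> even l \<and>
               (\<forall>j<l. \<not> t (prod_encode (2 * m + 1, j)))) \<and> cell_witness m r N"
              then show ?thesis
                by (intro exI[of _ "prod_encode (m, prod_encode (l, N))"]) (simp add: D_def)
            qed (auto simp: D_def)
          qed (auto simp: D_def)
          also have "\<dots> \<longleftrightarrow> x \<in> U \<or>
              (\<exists>m. p (2 * m + 1) = Some False \<and> x \<in> subbase_cell X S (cell_code m))"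
            unfolding plotkin_seq_rep_False[OF p(1)] cell_witness[OF r] open_rep_hit[OF u r] by blast
          also have "\<dots> \<longleftrightarrow> x \<in> V"
            using ranI[of X, OF r] by (simp add: V_def)
          finally show "\<exists>b. associate v r = Some b \<and> ((\<exists>n. b n) \<longleftrightarrow> x \<in> V)"
            using V[of t u r] unfolding v_def by simp
        qed (auto simp: V_def)
        then have "closed_rep X v = Some (ran X - V)"
          by (simp add: closed_rep_def)
        then obtain b where b: "E v = Some b" "sierpinski b = Some (ran X - V = {})"
          using E unfolding realizes_def by blast
        then have "(\<exists>n. \<Phi> v n = Some 1) \<longleftrightarrow> ran X - V = {}"
          by (simp add: \<Phi>(2)[OF b(1)] sierpinski_def)
        also have "\<dots> \<longleftrightarrow> A \<subseteq> U"
          unfolding A(2) V_def by blast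
        also have "\<dots> \<longleftrightarrow> U \<in> {U \<in> ran (open_rep X). A \<subseteq> U}"
          using ranI[of "open_rep X", OF u] by blast
        finally show "\<exists>b. associate Q u = Some b \<and> ((\<exists>n. b n) \<longleftrightarrow> U \<in> {U \<in> ran (open_rep X). A \<subseteq> U})"
          using B(2)[of t 0 u] unfolding Q_def v_def by simp
      qed blast
      then have "compact_rep X Q = Some A"
        unfolding compact_rep_eq_Some by (rule compact_nameI[OF Hausdorff A(1)])
      then show "\<exists>q. Some (\<lambda>i. B t (prod_encode (0, i))) = Some q \<and> compact_rep X q = Some A'"
        unfolding Q_def \<open>A' = A\<close> by blast
    qed
  qed
qed

text \<open>A compact name recognizes the open supersets of \<open>A\<close>. Feeding it names of
  the exteriors makes it semidecidable which cells to exclude.\<close>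

lemma computable_compact_rep_to_set_rep:
  assumes proper: "proper_subbase X S" and Hausdorff: "Hausdorff_space (rtop X)"
  shows "computable_map (compact_rep X) (set_rep X S \<circ>\<^sub>m plotkin_seq_rep) Some"
proof -
  define G where "G = (\<lambda>z c. Some (of_bool
    (exterior_witness (lproj c) (\<lambda>i. z (2 * i + 1)) (rproj c)) :: nat))"
  have "partial_recursive G"
    unfolding G_def total_recursive_def[symmetric] by (intro recursive_intros)
  then obtain C where C: "recursive_pred C"
    "\<And>t m r. \<exists>b. associate (\<lambda>i. C t (prod_encode (m, i))) r = Some b \<and>
      ((\<exists>n. b n) \<longleftrightarrow> (\<exists>n. G (join t r) (prod_encode (m, n)) = Some 1))"
    by (rule curry_semidecision) blast
  have G: "G (join t r) (prod_encode (m, c)) = Some 1 \<longleftrightarrow> exterior_witness m r c" for t r m c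
    by (simp only: G_def join_simps prod_encode_inverse fst_conv snd_conv option.inject of_bool_eq_1_iff)
  have ext: "open_rep X (\<lambda>i. C t (prod_encode (m, i))) = Some (cell_exterior S m)" for t m
  proof (rule open_repI)
    show "cell_exterior S m \<subseteq> ran X"
      using subbase_subset[OF subbase] by (auto simp: cell_exterior_def)
    show "\<exists>b. associate (\<lambda>i. C t (prod_encode (m, i))) r = Some b \<and> ((\<exists>n. b n) \<longleftrightarrow> x \<in> cell_exterior S m)"
      if "X r = Some x" for r x
      using C(2)[of t m r] unfolding G exterior_witness[OF that] .
  qed
  \<comment> \<open>Hits are recorded at even places only, so whichever comes first yields
    \<open>Some False\<close>; with no hit the value stays undefined.\<close>
  define T where "T Q c \<longleftrightarrow> odd (lproj c) \<and> even (rproj c) \<and>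
    hit Q (\<lambda>i. C Q (prod_encode (lproj c div 2, i))) (rproj c div 2)" for Q c
  show ?thesis
    unfolding computable_map_def
  proof (intro exI conjI)
    show "computable (\<lambda>Q. Some (T Q))"
      unfolding T_def by (intro computable_recursive_pred recursive_intros recursive_pred_comp[OF C(1)])
    show "realizes (\<lambda>Q. Some (T Q)) (compact_rep X) (set_rep X S \<circ>\<^sub>m plotkin_seq_rep) Some"
      unfolding realizes_def
    proof (intro allI impI)
      fix Q A A' assume "compact_rep X Q = Some A" and "Some A = Some A'"
      then have A: "compactin (rtop X) A" "open_rep (open_rep X) Q = Some {U \<in> ran (open_rep X). A \<subseteq> U}"
        and "A' = A"
        by (auto simp: compact_rep_eq_Some compact_name_def)
      define p where "p n = (if odd n \<and> A \<subseteq> cell_exterior S (n div 2) then Some False else None)" for n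
      have hit: "A \<subseteq> cell_exterior S m \<longleftrightarrow> (\<exists>c. hit Q (\<lambda>i. C Q (prod_encode (m, i))) c)" for m
        using open_rep_hit[OF A(2) ext] ranI[of "open_rep X", OF ext] by simp
      have "plotkin_seq_rep (T Q) = Some p"
        unfolding plotkin_seq_rep_eq_Some
      proof
        fix n
        have T: "T Q (prod_encode (n, l)) \<Longrightarrow> odd n \<and> even l" for l
          by (simp add: T_def)
        have "(\<exists>l. T Q (prod_encode (n, l))) \<longleftrightarrow> odd n \<and> A \<subseteq> cell_exterior S (n div 2)"
        proof
          assume *: "odd n \<and> A \<subseteq> cell_exterior S (n div 2)"
          then obtain c where "hit Q (\<lambda>i. C Q (prod_encode (n div 2, i))) c"
            using hit by blast
          with * show "\<exists>l. T Q (prod_encode (n, l))"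
            by (intro exI[of _ "2 * c"]) (simp add: T_def)
        qed (auto simp: T_def hit)
        moreover have "even (LEAST l. T Q (prod_encode (n, l)))" if "\<exists>l. T Q (prod_encode (n, l))"
          using T[OF LeastI_ex[OF that]] by blast
        ultimately show "p n = (if \<exists>l. T Q (prod_encode (n, l))
            then Some (odd (LEAST l. T Q (prod_encode (n, l)))) else None)"
          by (simp add: p_def)
      qed
      moreover have "set_rep X S p = Some A"
        by (intro set_rep_canonical[OF subbase proper Hausdorff A(1)]) (auto simp: p_def)
      ultimately show "\<exists>t. Some (T Q) = Some t \<and> (set_rep X S \<circ>\<^sub>m plotkin_seq_rep) t = Some A'"
        by (simp add: \<open>A' = A\<close>)
    qed
  qed
qed

end

theorem theorem21:
  fixes X :: "'a rspace"
  assumes "computably_admissible X"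
    and "computably_compact X"
    and "Hausdorff_space (rtop X)"
    and "\<exists>S. computable_dyadic_subbase X S \<and> proper_subbase X S"
  shows "\<exists>(\<delta> :: 'a rspace) (\<psi> :: (nat \<Rightarrow> plotkin) \<rightharpoonup> 'a set).
    rep_equiv \<delta> X \<and>
    ran \<psi> = {A. compactin (rtop X) A} \<and>
    rep_equiv (\<psi> \<circ>\<^sub>m plotkin_seq_rep) (compact_rep X) \<and>
    (\<forall>A x. compactin (rtop X) A \<longrightarrow> x \<in> ran X \<longrightarrow>
      (x \<in> A \<longleftrightarrow>
        (\<forall>p. \<psi> p = Some A \<longrightarrow> (\<exists>q. p \<preceq>\<^sub>T total_seq q \<and> \<delta> q = Some x))) \<and>
      (x \<in> A \<longleftrightarrow>
        (\<exists>p. \<psi> p = Some A \<and> (\<exists>q. p \<preceq>\<^sub>T total_seq q \<and> \<delta> q = Some x))))"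
proof -
  obtain S where "computable_dyadic_subbase X S" and proper: "proper_subbase X S"
    using assms(4) by blast
  then have S: "dyadic_subbase X S"
    and "computable_map (prod_rep nat_rep bit_rep) (open_rep X) (\<lambda>(n, i). Some (S n i))"
    by (simp_all only: computable_dyadic_subbase_def)
  then obtain s where "recursive_pred (\<lambda>t. s)"
    "\<And>k a. open_rep X (\<lambda>i. s (prod_encode (prod_encode (k, of_bool a), i))) = Some (S k a)"
    using computable_subbase_names by blast
  with S interpret named_subbase X S s
    by unfold_locales
  have ran: "ran (set_rep X S) = {A. compactin (rtop X) A}"
    by (rule ran_set_rep[OF S proper assms(3)])
  have equiv: "rep_equiv (set_rep X S \<circ>\<^sub>m plotkin_seq_rep) (compact_rep X)"
    unfolding rep_equiv_def
    using computable_set_rep_to_compact_rep[OF assms(2,3)]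
      computable_compact_rep_to_set_rep[OF proper assms(3)] by blast
  have match: "(x \<in> A \<longleftrightarrow> (\<forall>p. set_rep X S p = Some A \<longrightarrow>
        (\<exists>q. p \<preceq>\<^sub>T total_seq q \<and> point_rep X S q = Some x))) \<and>
      (x \<in> A \<longleftrightarrow> (\<exists>p. set_rep X S p = Some A \<and>
        (\<exists>q. p \<preceq>\<^sub>T total_seq q \<and> point_rep X S q = Some x)))"
    if A: "compactin (rtop X) A" and x: "x \<in> ran X" for A x
  proof -
    \<comment> \<open>A name exists, so the universal form is not vacuous and implies the
      existential one.\<close>
    have "\<exists>p. set_rep X S p = Some A"
      using A ran by (auto simp: ran_def)
    then show ?thesis
      using set_rep_matches_point_rep[OF _ x, of S _ A] by blast
  qed
  show ?thesis
    by (intro exI[of _ "point_rep X S"] exI[of _ "set_rep X S"] conjI[OF rep_equiv_point_rep]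
        conjI[OF ran] conjI[OF equiv] allI impI match)
qed

end
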